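(* Let $\bar u(x,t)\in\mathbb{R}^n$ be a smooth solution on $\mathbb{R}\times[0,T]$ of the balance law $$\partial_t u+\partial_xF(u)=G(u),$$ let $A$ be a symmetric positive definite $n\times n$ matrix, and let $\{u^{\varepsilon}\}_{\varepsilon>0}$ be a family of smooth solutions on $\mathbb{R}\times[0,T]$ (with associated $v=v^{\varepsilon}$) of the relaxation system $$\partial_tu+\partial_xv=0,\qquad \partial_tv+A\,\partial_xu=-\frac1\varepsilon\Big(v-F(u)+\int^xG(u(z,t))\,dz\Big).$$ Suppose that $\bar u$ and $u^{\varepsilon}$ decay sufficiently fast at infinity and that: (1) (Entropy) there are $\eta,q:\mathbb{R}^n\to\mathbb{R}$ and $\alpha,\beta>0$ with $\eta$ strictly convex, $\mathrm{D}\eta(u)\,\mathrm{D}F(u)=\mathrm{D}q(u)$, $\beta I\le \mathrm{D}^2\eta(u)\le\tfrac12\alpha I$ for all $u\in\mathbb{R}^n$, $\eta(u)\ge\eta(0)=0$ and $\mathrm{D}\eta(0)=0$; (2) (Subcharacteristic condition) for this $\alpha$ there is $\nu>0$ with $\tfrac12\big(A\,\mathrm{D}^2\eta(u)+\mathrm{D}^2\eta(u)A\big)-\alpha\,\mathrm{D}F(u)^{\top}\mathrm{D}F(u)\ge\nu I$ for all $u\in\mathbb{R}^n$; (3) for some $M>0$, $|\mathrm{D}^2F(u)|\le M$ and $|\mathrm{D}^3\eta(u)|\le M$ for all $u\in\mathbb{R}^n$; (4) (General source) for every compact set $\mathcal{A}\subset\mathbb{R}^n$ there is $L_{\mathcal{A}}>0$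 such that $|G(u)-G(w)|\le L_{\mathcal{A}}|u-w|$ for all $u\in\mathbb{R}^n$, $w\in\mathcal{A}$. Let $$\Psi(t)=\int_{\mathbb{R}}|\bar u-u^{\varepsilon}|^2+\varepsilon^2|(\bar u-u^{\varepsilon})_x|^2+\varepsilon^2|(\bar u-u^{\varepsilon})_t|^2\,dx .$$ Then $$\Psi(t)\le C\big(\Psi(0)+\varepsilon^2\big),\qquad t\in[0,T],$$ with $C=C(\bar u,\alpha,\beta,\nu,M,T)>0$ independent of $\varepsilon$.
   Context: $F,G:\mathbb{R}^n\to\mathbb{R}^n$ are column-vector valued, $F$ (and $\eta,q$) smooth, $G$ continuous with $G(0)=0$. $\mathrm{D}$ is the differential with respect to $u\in\mathbb{R}^n$, acting as a row operation; so $\mathrm{D}\eta$ is a row vector, $\mathrm{D}F$ the Jacobian, $\mathrm{D}^2\eta$ the Hessian. Matrix inequalities are in the sense of quadratic forms. $\int^xG(u(z,t))\,dz$ denotes an antiderivative in $x$ of $G(u(\cdot,t))$; eliminating $v$ shows that $u^{\varepsilon}$ satisfies $\partial_tu+\partial_xF(u)=G(u)+\varepsilon(Au_{xx}-u_{tt})$. The data $F,G,\eta,A$ are fixed, and constants may depend on them. "Decays sufficiently fast at infinity" means: the functions and their derivatives tend to $0$ as $|x|\to\infty$, uniformly for $t\in[0,T]$, rapidly enough that all integrals and norms over $\mathbb{R}$ that occur are finite and may be differentiated in $t$, and that boundary terms from integration in $x$ vanish. *)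

theory Defs
  imports "HOL-Analysis.Analysis"
begin

text \<open>
  Derivatives are taken within \<open>S\<close>, so that one notion covers functions on all of
  \<open>\<real>\<^sup>n\<close> and functions on a closed slab \<open>UNIV \<times> {0..T}\<close> with \<open>T > 0\<close>
  (smooth up to the boundary, one-sided time derivatives at \<open>0\<close> and \<open>T\<close>). It is only
  meaningful for sets \<open>S\<close> on which derivatives within \<open>S\<close> are unique.
\<close>

primrec Ck_on :: "nat \<Rightarrow> 'a set \<Rightarrow> ('a::euclidean_space \<Rightarrow> 'b::real_normed_vector) \<Rightarrow> bool" where
  "Ck_on 0 S f \<longleftrightarrow> continuous_on S f"
| "Ck_on (Suc k) S f \<longleftrightarrow>
     f differentiable_on S \<and>
     (\<forall>i\<in>Basis. Ck_on k S (\<lambda>x. frechet_derivative f (at x within S) i))"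

definition smooth_on :: "'a set \<Rightarrow> ('a::euclidean_space \<Rightarrow> 'b::real_normed_vector) \<Rightarrow> bool" where
  "smooth_on S f \<longleftrightarrow> (\<forall>k. Ck_on k S f)"

text \<open>
  \<open>Du f u\<close> is the array of partial derivatives of \<open>f\<close>, entry \<open>j\<close> being
  \<open>\<partial>f/\<partial>u\<^sub>j\<close>. For real-valued \<open>f\<close> it is the row vector \<open>Df\<close>, and
  \<open>Du (Du f)\<close> is the Hessian matrix. The norm on iterated arrays is the Euclidean norm of
  all entries. Note that for vector-valued \<open>f\<close> the array \<open>Du f u\<close> is the transpose of
  the Jacobian matrix \<open>jacobian f (at u)\<close>.
\<close>

definition Du :: "(real ^ 'n \<Rightarrow> 'b::real_normed_vector) \<Rightarrow> real ^ 'n \<Rightarrow> 'b ^ 'n" where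
  "Du f u = (\<chi> j. frechet_derivative f (at u) (axis j 1))"

definition quad_le :: "real ^ 'n ^ 'n \<Rightarrow> real ^ 'n ^ 'n \<Rightarrow> bool" where
  "quad_le P Q \<longleftrightarrow> (\<forall>x. x \<bullet> (P *v x) \<le> x \<bullet> (Q *v x))"

definition sym_pos_def :: "real ^ 'n ^ 'n \<Rightarrow> bool" where
  "sym_pos_def P \<longleftrightarrow> transpose P = P \<and> (\<forall>x. x \<noteq> 0 \<longrightarrow> 0 < x \<bullet> (P *v x))"

definition strictly_convex :: "('a::real_vector \<Rightarrow> real) \<Rightarrow> bool" where
  "strictly_convex f \<longleftrightarrow>
     (\<forall>x y s. x \<noteq> y \<longrightarrow> 0 < s \<longrightarrow> s < 1 \<longrightarrow>
        f ((1 - s) *\<^sub>R x + s *\<^sub>R y) < (1 - s) * f x + s * f y)"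

definition smooth_slab :: "real \<Rightarrow> (real \<Rightarrow> real \<Rightarrow> 'a::real_normed_vector) \<Rightarrow> bool" where
  "smooth_slab T u \<longleftrightarrow> smooth_on (UNIV \<times> {0..T}) (\<lambda>(x, t). u x t)"

definition Dx :: "(real \<Rightarrow> real \<Rightarrow> 'a::real_normed_vector) \<Rightarrow> real \<Rightarrow> real \<Rightarrow> 'a" where
  "Dx u x t = vector_derivative (\<lambda>y. u y t) (at x)"

definition Dt :: "real \<Rightarrow> (real \<Rightarrow> real \<Rightarrow> 'a::real_normed_vector) \<Rightarrow> real \<Rightarrow> real \<Rightarrow> 'a" where
  "Dt T u x t = vector_derivative (\<lambda>s. u x s) (at t within {0..T})"

text \<open>
  Sufficiently fast decay: the function and its derivatives up to second order (those
  occurring in the second-order equation satisfied by \<open>u\<close> when \<open>v\<close> is eliminated)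
  are bounded, uniformly in \<open>t\<close>, by some square integrable rate \<open>g\<close> that vanishes at
  infinity. Products of two such functions are then dominated by the integrable function
  \<open>g\<^sup>2\<close>, uniformly in \<open>t\<close>, and vanish as \<open>\<bar>x\<bar>\<close> tends to infinity.
\<close>

definition decays_fast :: "real \<Rightarrow> (real \<Rightarrow> real \<Rightarrow> 'a::real_normed_vector) \<Rightarrow> bool" where
  "decays_fast T u \<longleftrightarrow>
     (\<exists>g::real \<Rightarrow> real.
        (g \<longlongrightarrow> 0) at_infinity \<and>
        integrable lborel (\<lambda>x. (g x)\<^sup>2) \<and>
        (\<forall>k l x. \<forall>t\<in>{0..T}. k + l \<le> 2 \<longrightarrow> norm ((Dx ^^ k) ((Dt T ^^ l) u) x t) \<le> g x))"

definition balance_law_solution ::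
  "(real ^ 'n \<Rightarrow> real ^ 'n) \<Rightarrow> (real ^ 'n \<Rightarrow> real ^ 'n) \<Rightarrow> real \<Rightarrow>
   (real \<Rightarrow> real \<Rightarrow> real ^ 'n) \<Rightarrow> bool" where
  "balance_law_solution F G T u \<longleftrightarrow>
     smooth_slab T u \<and>
     (\<forall>x. \<forall>t\<in>{0..T}. Dt T u x t + Dx (\<lambda>x t. F (u x t)) x t = G (u x t))"

text \<open>\<open>W\<close> is the antiderivative \<open>\<integral>\<^sup>x G(u(z,t)) dz\<close>, with an arbitrary constant of
  integration at each time.\<close>

definition relaxation_solution ::
  "(real ^ 'n \<Rightarrow> real ^ 'n) \<Rightarrow> (real ^ 'n \<Rightarrow> real ^ 'n) \<Rightarrow> real ^ 'n ^ 'n \<Rightarrow> real \<Rightarrow> real \<Rightarrow>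
   (real \<Rightarrow> real \<Rightarrow> real ^ 'n) \<Rightarrow> (real \<Rightarrow> real \<Rightarrow> real ^ 'n) \<Rightarrow> bool" where
  "relaxation_solution F G A \<epsilon> T u v \<longleftrightarrow>
     smooth_slab T u \<and> smooth_slab T v \<and>
     (\<exists>W. \<forall>x. \<forall>t\<in>{0..T}.
        ((\<lambda>z. W z t) has_vector_derivative G (u x t)) (at x) \<and>
        Dt T u x t + Dx v x t = 0 \<and>
        Dt T v x t + A *v Dx u x t = - (1 / \<epsilon>) *\<^sub>R (v x t - F (u x t) + W x t))"

definition Psi ::
  "real \<Rightarrow> (real \<Rightarrow> real \<Rightarrow> real ^ 'n) \<Rightarrow> real \<Rightarrow> (real \<Rightarrow> real \<Rightarrow> real ^ 'n) \<Rightarrow> real \<Rightarrow> real" where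
  "Psi T ubar \<epsilon> u t =
     (LINT x|lborel.
        (norm (ubar x t - u x t))\<^sup>2
        + \<epsilon>\<^sup>2 * (norm (Dx (\<lambda>x t. ubar x t - u x t) x t))\<^sup>2
        + \<epsilon>\<^sup>2 * (norm (Dt T (\<lambda>x t. ubar x t - u x t) x t))\<^sup>2)"

end

theory Submission
  imports Defs
begin

text \<open>
  Write \<open>z\<close> for the smooth solution of the balance law, \<open>w = u - z\<close>, \<open>p = D\<eta>(u) - D\<eta>(z)\<close> and
  \<open>\<eta>(u|z) = \<eta>(u) - \<eta>(z) - D\<eta>(z) w\<close>. Testing the equation for \<open>w\<close> with \<open>p + \<alpha> \<epsilon> w\<^sub>t\<close>
  produces a pointwise balance \<open>e\<^sub>t + f\<^sub>x = r\<close> for the energy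
  \<open>e = \<eta>(u|z) + \<epsilon> p \<bullet> w\<^sub>t + (\<alpha> \<epsilon>\<^sup>2 / 2) (|w\<^sub>t|\<^sup>2 + w\<^sub>x \<bullet> A w\<^sub>x)\<close>, in which the
  subcharacteristic condition makes the part of \<open>r\<close> quadratic in \<open>w\<^sub>x\<close>, \<open>w\<^sub>t\<close> dissipative.
  Since \<open>|p|\<^sup>2 \<le> \<alpha> \<eta>(u|z)\<close>, the energy is pointwise equivalent to the integrand of \<open>\<Psi>\<close>, uniformly
  in \<open>\<epsilon>\<close>, and \<open>r \<le> K e + O(\<epsilon>\<^sup>2) |A z\<^sub>x\<^sub>x - z\<^sub>t\<^sub>t|\<^sup>2\<close>. Multiplying by \<open>exp (- K t)\<close> turns
  the balance into a divergence inequality that can be integrated directly, so no Gronwall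
  inequality is needed.
\<close>

subsection \<open>Smooth functions on a slab\<close>

text \<open>The multiplier is forced by the wave term. Tested with \<open>p\<close>, the viscous
  term \<open>\<epsilon> A w_xx\<close> is dissipative, but \<open>- \<epsilon> w_tt\<close> leaves
  \<open>\<epsilon> w_t \<bullet> H w_t\<close> with the wrong sign. The second multiplier
  \<open>\<alpha> \<epsilon> w_t\<close> contributes \<open>\<alpha> \<epsilon> |w_t|^2\<close>,
  which dominates it since \<open>H \<le> \<alpha> / 2\<close>; the price is the cross term
  \<open>\<alpha> \<epsilon> w_t \<bullet> J w_x\<close>, and this is what the subcharacteristic
  condition pays for. No bound on \<open>u\<close> uniform in \<epsilon> is available, so everything
  is expanded about \<open>z\<close>, and the global bounds on the second derivative of
  \<open>F\<close> and the third derivative of \<open>\<eta>\<close> control the errors. Terms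
  linear in \<open>w\<close> with coefficients of order one could not be absorbed into a quadratic
  energy; they cancel because \<open>H J\<close> is symmetric, a consequence of the entropy
  compatibility. The consistency error \<open>\<epsilon> (A z_xx - z_tt)\<close> is always paired
  with \<open>p\<close> or \<open>\<epsilon> w_t\<close>; Young's inequality turns it into energy
  plus a term of order \<epsilon>^2, the one in the claim.\<close>

lemma frechet_derivative_within_cong:
  assumes "\<And>x. x \<in> S \<Longrightarrow> f x = g x" "x \<in> S"
  shows "frechet_derivative f (at x within S) = frechet_derivative g (at x within S)"
proof -
  have "(f has_derivative f') (at x within S) \<longleftrightarrow> (g has_derivative f') (at x within S)" for f'
    by (intro iffI; erule has_derivative_transform[OF assms(2), rotated]) (simp_all add: assms(1))
  then show ?thesis
    by (simp add: frechet_derivative_def)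
qed

text \<open>Needed because \<open>Dx u\<close> and \<open>Dt T u\<close> agree with the Frechet
  partial derivatives only at points of the slab.\<close>

lemma Ck_on_cong:
  assumes "\<And>x. x \<in> S \<Longrightarrow> f x = g x"
  shows "Ck_on k S f \<longleftrightarrow> Ck_on k S g"
  using assms
proof (induction k arbitrary: f g)
  case 0
  then show ?case
    using continuous_on_cong[of S S f g] by simp
next
  case (Suc k)
  have "f differentiable_on S \<longleftrightarrow> g differentiable_on S"
    using Suc.prems by (simp add: differentiable_on_def differentiable_def)
      (metis has_derivative_transform)
  moreover have "Ck_on k S (\<lambda>x. frechet_derivative f (at x within S) i) \<longleftrightarrow>
      Ck_on k S (\<lambda>x. frechet_derivative g (at x within S) i)" for i
    by (rule Suc.IH) (simp add: frechet_derivative_within_cong[OF Suc.prems])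
  ultimately show ?case
    by simp
qed

lemma smooth_on_cong:
  "(\<And>x. x \<in> S \<Longrightarrow> f x = g x) \<Longrightarrow> smooth_on S f \<longleftrightarrow> smooth_on S g"
  by (simp add: smooth_on_def Ck_on_cong[of S f g])

lemma smooth_on_imp_continuous_on: "smooth_on S f \<Longrightarrow> continuous_on S f"
  unfolding smooth_on_def by (metis Ck_on.simps(1))

lemma smooth_on_has_derivative:
  assumes "smooth_on S f" "x \<in> S"
  shows "(f has_derivative frechet_derivative f (at x within S)) (at x within S)"
proof -
  have "Ck_on (Suc 0) S f"
    using assms(1) unfolding smooth_on_def by blast
  with assms(2) show ?thesis
    by (simp add: differentiable_on_def frechet_derivative_works)
qed

lemma smooth_on_frechet_derivative:
  assumes "smooth_on S f" "i \<in> Basis"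
  shows "smooth_on S (\<lambda>x. frechet_derivative f (at x within S) i)"
  using assms unfolding smooth_on_def by (metis Ck_on.simps(2))

text \<open>This is how smoothness passes from \<open>f\<close> to the array-valued map
  \<open>Du f\<close>, whose entries are directional derivatives of \<open>f\<close>.\<close>

lemma Ck_on_vec:
  fixes f :: "'a::euclidean_space \<Rightarrow> 'b::euclidean_space ^ 'n"
  assumes "\<And>j. Ck_on k UNIV (\<lambda>x. f x $ j)"
  shows "Ck_on k UNIV f"
  using assms
proof (induction k arbitrary: f)
  case 0
  then have "continuous_on UNIV (\<lambda>x. \<chi> j. f x $ j)"
    by (intro continuous_on_vec_lambda) simp
  then show ?case
    by simp
next
  case (Suc k)
  have has: "(f has_derivative (\<lambda>h. \<chi> j. frechet_derivative (\<lambda>x. f x $ j) (at x) h)) (at x)" for x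
  proof (subst has_derivative_componentwise_within, intro ballI)
    fix i :: "'b ^ 'n"
    assume "i \<in> Basis"
    then obtain j b where i: "i = axis j b" "b \<in> Basis"
      by (auto simp: Basis_vec_def)
    have "((\<lambda>x. f x $ j) has_derivative frechet_derivative (\<lambda>x. f x $ j) (at x)) (at x)"
      using Suc.prems[of j] by (simp add: differentiable_on_def frechet_derivative_works)
    then show "((\<lambda>x. f x \<bullet> i) has_derivative
        (\<lambda>h. (\<chi> j. frechet_derivative (\<lambda>x. f x $ j) (at x) h) \<bullet> i)) (at x)"
      by (auto simp: i inner_axis intro!: derivative_eq_intros)
  qed
  then have "f differentiable_on UNIV"
    by (auto simp: differentiable_on_def differentiable_def)
  moreover have "Ck_on k UNIV (\<lambda>x. frechet_derivative f (at x) i)" if "i \<in> Basis" for i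
    using Suc.prems that by (intro Suc.IH) (simp add: frechet_derivative_at[OF has, symmetric])
  ultimately show ?case
    by simp
qed

text \<open>The Frechet derivative within the slab is restricted to the horizontal line and to the
  vertical segment through the point. The line lies entirely in the slab, so the x-derivative is
  two-sided; the time derivative stays one-sided at the end points, where \<open>0 < T\<close> makes
  it unique.\<close>

lemma smooth_slab_derivatives:
  fixes u :: "real \<Rightarrow> real \<Rightarrow> 'a::euclidean_space"
  assumes u: "smooth_slab T u" and T: "0 < T" and t: "t \<in> {0..T}"
  shows "((\<lambda>y. u y t) has_vector_derivative Dx u x t) (at x)"
    and "((\<lambda>s. u x s) has_vector_derivative Dt T u x t) (at t within {0..T})"
    and "Dx u x t = frechet_derivative (\<lambda>(x, t). u x t) (at (x, t) within UNIV \<times> {0..T}) (1, 0)"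
    and "Dt T u x t = frechet_derivative (\<lambda>(x, t). u x t) (at (x, t) within UNIV \<times> {0..T}) (0, 1)"
proof -
  let ?S = "UNIV \<times> {0..T} :: (real \<times> real) set" and ?f = "\<lambda>(x, t). u x t"
  let ?D = "frechet_derivative ?f (at (x, t) within ?S)"
  have D: "(?f has_derivative ?D) (at (x, t) within ?S)"
    using u t unfolding smooth_slab_def by (intro smooth_on_has_derivative) auto
  have lin: "(\<lambda>h. ?D (h *\<^sub>R v)) = (\<lambda>h. h *\<^sub>R ?D v)" for v
    using has_derivative_linear[OF D] by (simp add: linear_scale)
  have "(?f has_derivative ?D) (at (x, t) within (\<lambda>y. (y, t)) ` UNIV)"
    by (rule has_derivative_subset[OF D]) (use t in auto)
  from has_derivative_in_compose[OF has_derivative_Pair[OF has_derivative_ident has_derivative_const] this]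
  have "((\<lambda>y. ?f (y, t)) has_derivative (\<lambda>h. ?D (h, 0))) (at x)" .
  then have x: "((\<lambda>y. u y t) has_vector_derivative ?D (1, 0)) (at x)"
    unfolding has_vector_derivative_def lin[of "(1, 0)", symmetric] by simp
  have "(?f has_derivative ?D) (at (x, t) within (\<lambda>s. (x, s)) ` {0..T})"
    by (rule has_derivative_subset[OF D]) auto
  from has_derivative_in_compose[OF has_derivative_Pair[OF has_derivative_const has_derivative_ident] this]
  have "((\<lambda>s. ?f (x, s)) has_derivative (\<lambda>h. ?D (0, h))) (at t within {0..T})" .
  then have t': "((\<lambda>s. u x s) has_vector_derivative ?D (0, 1)) (at t within {0..T})"
    unfolding has_vector_derivative_def lin[of "(0, 1)", symmetric] by simp
  show "Dx u x t = ?D (1, 0)"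
    unfolding Dx_def using x by (rule vector_derivative_at)
  with x show "((\<lambda>y. u y t) has_vector_derivative Dx u x t) (at x)"
    by simp
  show "Dt T u x t = ?D (0, 1)"
    unfolding Dt_def using T t t' by (rule vector_derivative_within_closed_interval)
  with t' show "((\<lambda>s. u x s) has_vector_derivative Dt T u x t) (at t within {0..T})"
    by simp
qed

lemma smooth_slab_Dx:
  fixes u :: "real \<Rightarrow> real \<Rightarrow> 'a::euclidean_space"
  assumes "smooth_slab T u" "0 < T"
  shows "smooth_slab T (Dx u)"
  unfolding smooth_slab_def
proof (subst smooth_on_cong)
  show "smooth_on (UNIV \<times> {0..T})
      (\<lambda>p. frechet_derivative (\<lambda>(x, t). u x t) (at p within UNIV \<times> {0..T}) (1, 0))"
    using assms(1) unfolding smooth_slab_def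
    by (rule smooth_on_frechet_derivative) (simp add: Basis_prod_def)
qed (use smooth_slab_derivatives(3)[OF assms] in auto)

lemma smooth_slab_Dt:
  fixes u :: "real \<Rightarrow> real \<Rightarrow> 'a::euclidean_space"
  assumes "smooth_slab T u" "0 < T"
  shows "smooth_slab T (Dt T u)"
  unfolding smooth_slab_def
proof (subst smooth_on_cong)
  show "smooth_on (UNIV \<times> {0..T})
      (\<lambda>p. frechet_derivative (\<lambda>(x, t). u x t) (at p within UNIV \<times> {0..T}) (0, 1))"
    using assms(1) unfolding smooth_slab_def
    by (rule smooth_on_frechet_derivative) (simp add: Basis_prod_def)
qed (use smooth_slab_derivatives(4)[OF assms] in auto)

text \<open>
  Differentiating \<open>f x t - f x0 t = \<integral>\<^bsub>x0\<^esub>\<^bsup>x\<^esup> fx z t dz\<close> under the integral sign gives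
  the claim also at the end points of the time interval.
\<close>

lemma mixed_partials_commute:
  fixes f fx ft fxt ftx :: "real \<Rightarrow> real \<Rightarrow> 'a::euclidean_space"
  assumes fx: "\<And>x t. t \<in> {a..b} \<Longrightarrow> ((\<lambda>x. f x t) has_vector_derivative fx x t) (at x)"
    and ft: "\<And>x t. t \<in> {a..b} \<Longrightarrow> ((\<lambda>t. f x t) has_vector_derivative ft x t) (at t within {a..b})"
    and fxt: "\<And>x t. t \<in> {a..b} \<Longrightarrow> ((\<lambda>t. fx x t) has_vector_derivative fxt x t) (at t within {a..b})"
    and ftx: "\<And>x t. t \<in> {a..b} \<Longrightarrow> ((\<lambda>x. ft x t) has_vector_derivative ftx x t) (at x)"
    and cont: "continuous_on (UNIV \<times> {a..b}) (\<lambda>(x, t). fxt x t)"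
    and ab: "a < b" and t0: "t0 \<in> {a..b}"
  shows "ftx x0 t0 = fxt x0 t0"
proof -
  have int: "ft x t0 - ft x0 t0 = integral {x0..x} (\<lambda>z. fxt z t0)" if x: "x0 \<le> x" for x
  proof -
    have fxint: "((\<lambda>z. fx z t) has_integral (f x t - f x0 t)) {x0..x}" if "t \<in> {a..b}" for t
      using fx that x
      by (intro fundamental_theorem_of_calculus) (auto intro: has_vector_derivative_at_within)
    have "((\<lambda>t. integral {x0..x} (\<lambda>z. fx z t)) has_vector_derivative
        integral {x0..x} (\<lambda>z. fxt z t0)) (at t0 within {a..b})"
      unfolding interval_cbox[of x0 x]
    proof (rule leibniz_rule_vector_derivative)
      show "(\<lambda>z. fx z t) integrable_on cbox x0 x" if "t \<in> {a..b}" for t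
        using fxint[OF that] by (auto simp: integrable_on_def)
      show "continuous_on ({a..b} \<times> cbox x0 x) (\<lambda>(t, z). fxt z t)"
        using continuous_on_compose2[OF cont, of "{a..b} \<times> cbox x0 x" "\<lambda>(t, z). (z, t)"]
        by (force simp: case_prod_unfold intro!: continuous_intros)
    qed (use fxt t0 in auto)
    then have "((\<lambda>t. f x t - f x0 t) has_vector_derivative
        integral {x0..x} (\<lambda>z. fxt z t0)) (at t0 within {a..b})"
      by (rule has_vector_derivative_transform[OF t0, rotated 1])
        (simp add: integral_unique[OF fxint])
    moreover have "((\<lambda>t. f x t - f x0 t) has_vector_derivative ft x t0 - ft x0 t0)
        (at t0 within {a..b})"
      using ft t0 by (intro has_vector_derivative_diff) auto
    moreover have "at t0 within {a..b} \<noteq> bot"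
      using ab t0 by (simp add: at_within_Icc_at trivial_limit_within islimpt_Icc)
    ultimately show ?thesis
      by (meson vector_derivative_unique_within)
  qed
  \<comment> \<open>The identity \<open>int\<close> covers only \<open>x0 \<le> x\<close>, so both
    sides are differentiated from the right at \<open>x0\<close>; a one-sided derivative already
    determines \<open>ftx x0 t0\<close>.\<close>
  have "continuous_on {x0..x0 + 1} (\<lambda>z. fxt z t0)"
    using continuous_on_compose2[OF cont, of "{x0..x0 + 1}" "\<lambda>z. (z, t0)"] t0
    by (force intro!: continuous_intros)
  then have "((\<lambda>x. integral {x0..x} (\<lambda>z. fxt z t0)) has_vector_derivative fxt x0 t0)
      (at x0 within {x0..x0 + 1})"
    by (intro integral_has_vector_derivative) auto
  then have "((\<lambda>x. ft x t0 - ft x0 t0) has_vector_derivative fxt x0 t0) (at x0 within {x0..x0 + 1})"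
    by (rule has_vector_derivative_transform[rotated 2]) (use int in auto)
  moreover have "((\<lambda>x. ft x t0 - ft x0 t0) has_vector_derivative ftx x0 t0 - 0)
      (at x0 within {x0..x0 + 1})"
    using ftx[OF t0] by (intro has_vector_derivative_diff) (auto intro: has_vector_derivative_at_within)
  moreover have "at x0 within {x0..x0 + 1} \<noteq> bot"
    by (simp add: trivial_limit_within islimpt_Icc)
  ultimately have "fxt x0 t0 = ftx x0 t0 - 0"
    by (meson vector_derivative_unique_within)
  then show ?thesis
    by simp
qed

lemma smooth_slab_continuous_on:
  "smooth_slab T u \<Longrightarrow> continuous_on (UNIV \<times> {0..T}) (\<lambda>p. u (fst p) (snd p))"
  unfolding smooth_slab_def by (drule smooth_on_imp_continuous_on) (simp add: case_prod_unfold)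

lemma smooth_slab_Dx_Dt:
  fixes u :: "real \<Rightarrow> real \<Rightarrow> 'a::euclidean_space"
  assumes u: "smooth_slab T u" and T: "0 < T" and t: "t \<in> {0..T}"
  shows "Dx (Dt T u) x t = Dt T (Dx u) x t"
proof (rule mixed_partials_commute[where f = u and a = 0 and b = T, OF _ _ _ _ _ T t])
  note D = smooth_slab_derivatives(1,2)[OF _ T] and ux = smooth_slab_Dx[OF u T]
    and ut = smooth_slab_Dt[OF u T]
  show "continuous_on (UNIV \<times> {0..T}) (\<lambda>(x, t). Dt T (Dx u) x t)"
    using smooth_slab_continuous_on[OF smooth_slab_Dt[OF ux T]] by (simp add: case_prod_unfold)
qed (use u T in \<open>auto intro!: smooth_slab_derivatives(1,2) smooth_slab_Dx smooth_slab_Dt\<close>)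

subsection \<open>Gradients, Hessians and Taylor estimates\<close>

text \<open>Cauchy-Schwarz over the index. No dimensional factor appears, because an array carries
  the Euclidean norm of the norms of its entries.\<close>

lemma norm_sum_scaleR_vec_le:
  fixes D :: "'b::real_normed_vector ^ 'n"
  shows "norm (\<Sum>j\<in>UNIV. h $ j *\<^sub>R D $ j) \<le> norm D * norm h"
proof -
  have "norm (\<Sum>j\<in>UNIV. h $ j *\<^sub>R D $ j) \<le> (\<Sum>j\<in>UNIV. \<bar>norm (D $ j)\<bar> * \<bar>h $ j\<bar>)"
    by (rule sum_norm_le) (simp add: mult.commute)
  also have "\<dots> \<le> norm D * norm h"
    unfolding norm_vec_def using L2_set_mult_ineq[of "\<lambda>j. norm (D $ j)" "\<lambda>j. h $ j" UNIV]
    by (simp add: L2_set_def)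
  finally show ?thesis .
qed

lemma norm_matrix_vector_mult_le:
  fixes P :: "real ^ 'n ^ 'm"
  shows "norm (P *v h) \<le> norm P * norm h"
proof -
  have "norm (P *v h) \<le> L2_set (\<lambda>i. norm (P $ i) * norm h) UNIV"
    unfolding norm_vec_def[of "P *v h"]
    by (intro L2_set_mono) (auto simp: matrix_mult_dot Cauchy_Schwarz_ineq2)
  also have "\<dots> = norm P * norm h"
    unfolding norm_vec_def[of P] by (simp add: L2_set_left_distrib)
  finally show ?thesis .
qed

lemma mat_vector_mult [simp]: "mat c *v (x :: real ^ 'n) = c *\<^sub>R x"
  by (simp add: vec_eq_iff matrix_vector_mult_def mat_def if_distrib if_distribR sum.delta cong: if_cong)

lemma smooth_on_Du:
  fixes f :: "real ^ 'n \<Rightarrow> 'b::euclidean_space"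
  assumes "smooth_on UNIV f"
  shows "smooth_on UNIV (Du f)"
  unfolding smooth_on_def
proof (intro allI Ck_on_vec)
  fix k and j :: 'n
  have "smooth_on UNIV (\<lambda>u. frechet_derivative f (at u) (axis j 1))"
    using smooth_on_frechet_derivative[OF assms] by (simp add: axis_in_Basis_iff)
  then show "Ck_on k UNIV (\<lambda>u. Du f u $ j)"
    by (simp add: Du_def smooth_on_def)
qed

lemma has_derivative_Du:
  fixes f :: "real ^ 'n \<Rightarrow> 'b::euclidean_space"
  assumes "smooth_on UNIV f"
  shows "(f has_derivative (\<lambda>h. \<Sum>j\<in>UNIV. h $ j *\<^sub>R Du f u $ j)) (at u)"
proof -
  let ?D = "frechet_derivative f (at u)"
  have D: "(f has_derivative ?D) (at u)"
    using smooth_on_has_derivative[OF assms, of u] by simp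
  have "?D h = (\<Sum>j\<in>UNIV. h $ j *\<^sub>R Du f u $ j)" for h
  proof -
    have "?D h = ?D (\<Sum>j\<in>UNIV. h $ j *\<^sub>R axis j 1)"
      by (simp add: basis_expansion scalar_mult_eq_scaleR[symmetric])
    also have "\<dots> = (\<Sum>j\<in>UNIV. h $ j *\<^sub>R Du f u $ j)"
      using has_derivative_linear[OF D] by (simp add: linear_sum linear_scale Du_def)
    finally show ?thesis .
  qed
  then have "?D = (\<lambda>h. \<Sum>j\<in>UNIV. h $ j *\<^sub>R Du f u $ j)"
    by (rule ext)
  with D show ?thesis
    by simp
qed

lemma has_derivative_gradient:
  fixes f :: "real ^ 'n \<Rightarrow> real"
  assumes "smooth_on UNIV f"
  shows "(f has_derivative (\<lambda>h. Du f u \<bullet> h)) (at u)"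
  using has_derivative_Du[OF assms, of u] by (simp add: inner_vec_def mult.commute)

lemma has_derivative_jacobian:
  fixes F :: "real ^ 'n \<Rightarrow> real ^ 'm"
  assumes "smooth_on UNIV F"
  shows "(F has_derivative (\<lambda>h. jacobian F (at u) *v h)) (at u)"
proof -
  have "F differentiable at u"
    using has_derivative_Du[OF assms, of u] by (auto simp: differentiable_def)
  then show ?thesis
    by (simp add: jacobian_works[symmetric])
qed

lemma jacobian_mult_eq_sum_Du:
  fixes F :: "real ^ 'n \<Rightarrow> real ^ 'm"
  assumes "smooth_on UNIV F"
  shows "jacobian F (at u) *v h = (\<Sum>j\<in>UNIV. h $ j *\<^sub>R Du F u $ j)"
  using has_derivative_unique[OF has_derivative_jacobian[OF assms] has_derivative_Du[OF assms]]
  by (rule fun_cong)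

lemma norm_diff_le_of_Du_bound:
  fixes f :: "real ^ 'n \<Rightarrow> 'b::euclidean_space"
  assumes "smooth_on UNIV f" "\<And>u. norm (Du f u) \<le> M"
  shows "norm (f y - f z) \<le> M * norm (y - z)"
proof (rule differentiable_bound[where S = UNIV])
  show "onorm (\<lambda>h. \<Sum>j\<in>UNIV. h $ j *\<^sub>R Du f u $ j) \<le> M" for u
  proof (rule onorm_le)
    show "norm (\<Sum>j\<in>UNIV. h $ j *\<^sub>R Du f u $ j) \<le> M * norm h" for h
      using norm_sum_scaleR_vec_le[of h "Du f u"] mult_right_mono[OF assms(2), of "norm h" u]
      by simp
  qed
qed (use has_derivative_Du[OF assms(1)] in auto)

text \<open>The mean value inequality is applied to \<open>f\<close> minus its linearization at
  \<open>z\<close>, on the segment only, where the derivatives differ by at most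
  \<open>M * norm (y - z)\<close>. This route gives \<open>M\<close> in place of the sharp
  \<open>M / 2\<close>.\<close>

lemma taylor_le_of_Du_Du_bound:
  fixes f :: "real ^ 'n \<Rightarrow> 'b::euclidean_space"
  assumes f: "smooth_on UNIV f" and M: "\<And>u. norm (Du (Du f) u) \<le> M"
  shows "norm (f y - f z - (\<Sum>j\<in>UNIV. (y - z) $ j *\<^sub>R Du f z $ j)) \<le> M * (norm (y - z))\<^sup>2"
proof -
  let ?L = "\<lambda>u h. \<Sum>j\<in>UNIV. h $ j *\<^sub>R Du f u $ j"
  let ?g = "\<lambda>u. f u - ?L z u"
  have "norm (?g y - ?g z) \<le> (M * norm (y - z)) * norm (y - z)"
  proof (rule differentiable_bound[where S = "closed_segment z y"])
    show "(?g has_derivative (\<lambda>h. ?L u h - ?L z h)) (at u within closed_segment z y)" for u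
      by (rule has_derivative_at_withinI)
        (auto intro!: derivative_eq_intros has_derivative_Du[OF f]
          bounded_linear_imp_has_derivative[OF bounded_linear_vec_nth])
    show "onorm (\<lambda>h. ?L u h - ?L z h) \<le> M * norm (y - z)" if u: "u \<in> closed_segment z y" for u
    proof (rule onorm_le)
      fix h
      have "?L u h - ?L z h = (\<Sum>j\<in>UNIV. h $ j *\<^sub>R (Du f u - Du f z) $ j)"
        by (simp add: sum_subtractf scaleR_diff_right)
      also have "norm \<dots> \<le> norm (Du f u - Du f z) * norm h"
        by (rule norm_sum_scaleR_vec_le)
      also have "\<dots> \<le> (M * norm (u - z)) * norm h"
        by (intro mult_right_mono norm_diff_le_of_Du_bound[OF smooth_on_Du[OF f] M]) simp
      also have "\<dots> \<le> (M * norm (y - z)) * norm h"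
        using segment_bound(1)[OF u] order_trans[OF norm_ge_zero M]
        by (intro mult_right_mono mult_left_mono) (auto simp: norm_minus_commute)
      finally show "norm (?L u h - ?L z h) \<le> M * norm (y - z) * norm h" .
    qed
  qed auto
  also have "?g y - ?g z = f y - f z - ?L z (y - z)"
    by (simp add: sum_subtractf scaleR_diff_left)
  finally show ?thesis
    by (simp add: power2_eq_square mult.assoc)
qed

text \<open>Equality of mixed partials on the plane spanned by \<open>a\<close> and \<open>b\<close>
  through \<open>u\<close>, taken at the end point \<open>t = 0\<close> of the interval
  \<open>{0..1}\<close>. Vector values are allowed because the symmetry is used for \<open>F\<close>
  as well as for real functions.\<close>

lemma Du_Du_commute:
  fixes f :: "real ^ 'n \<Rightarrow> 'b::euclidean_space"
  assumes f: "smooth_on UNIV f"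
  shows "(\<Sum>i\<in>UNIV. a $ i *\<^sub>R (\<Sum>j\<in>UNIV. b $ j *\<^sub>R Du (Du f) u $ j) $ i) =
    (\<Sum>i\<in>UNIV. b $ i *\<^sub>R (\<Sum>j\<in>UNIV. a $ j *\<^sub>R Du (Du f) u $ j) $ i)"
    (is "?D2 u a b = ?D2 u b a")
proof -
  let ?p = "\<lambda>x t. u + x *\<^sub>R a + t *\<^sub>R b"
  let ?D = "\<lambda>v h. \<Sum>j\<in>UNIV. h $ j *\<^sub>R Du f v $ j"
  have D: "(f has_derivative ?D v) (at v within S)" for v S
    by (rule has_derivative_at_withinI[OF has_derivative_Du[OF f]])
  have DD: "((\<lambda>v. ?D v h) has_derivative (\<lambda>k. ?D2 v h k)) (at v within S)" for v h S
  proof (rule has_derivative_at_withinI, intro has_derivative_sum has_derivative_scaleR_right)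
    fix i :: 'n
    show "((\<lambda>v. Du f v $ i) has_derivative (\<lambda>k. (\<Sum>j\<in>UNIV. k $ j *\<^sub>R Du (Du f) v $ j) $ i)) (at v)"
      by (intro bounded_linear.has_derivative[OF bounded_linear_vec_nth]
          has_derivative_Du[OF smooth_on_Du[OF f]])
  qed
  have px: "((\<lambda>x. ?p x t) has_derivative (\<lambda>h. h *\<^sub>R a)) (at x within S)" for x t S
    by (auto intro!: derivative_eq_intros)
  have pt: "((\<lambda>t. ?p x t) has_derivative (\<lambda>h. h *\<^sub>R b)) (at t within S)" for x t S
    by (auto intro!: derivative_eq_intros)
  have lin: "?D v (c *\<^sub>R h) = c *\<^sub>R ?D v h" for v c h
    by (simp add: scaleR_sum_right)
  have lin2: "?D2 v h (c *\<^sub>R k) = c *\<^sub>R ?D2 v h k" for v c h k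
    by (simp add: scaleR_sum_right sum_component mult.left_commute)
  have "?D2 (?p 0 0) b a = ?D2 (?p 0 0) a b"
  proof (rule mixed_partials_commute[where f = "\<lambda>x t. f (?p x t)" and a = 0 and b = 1
        and fx = "\<lambda>x t. ?D (?p x t) a" and ft = "\<lambda>x t. ?D (?p x t) b"
        and fxt = "\<lambda>x t. ?D2 (?p x t) a b" and ftx = "\<lambda>x t. ?D2 (?p x t) b a"
        and ?t0.0 = 0 and ?x0.0 = 0])
    show "((\<lambda>x. f (?p x t)) has_vector_derivative ?D (?p x t) a) (at x)" for x t
      unfolding has_vector_derivative_def lin[symmetric]
      by (rule has_derivative_in_compose[OF px D])
    show "((\<lambda>t. f (?p x t)) has_vector_derivative ?D (?p x t) b) (at t within {0..1})" for x t
      unfolding has_vector_derivative_def lin[symmetric]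
      by (rule has_derivative_in_compose[OF pt D])
    show "((\<lambda>x. ?D (?p x t) b) has_vector_derivative ?D2 (?p x t) b a) (at x)" for x t
      unfolding has_vector_derivative_def lin2[symmetric]
      by (rule has_derivative_in_compose[OF px DD])
    show "((\<lambda>t. ?D (?p x t) a) has_vector_derivative ?D2 (?p x t) a b) (at t within {0..1})" for x t
      unfolding has_vector_derivative_def lin2[symmetric]
      by (rule has_derivative_in_compose[OF pt DD])
    have "continuous_on UNIV (Du (Du f))"
      by (intro smooth_on_imp_continuous_on smooth_on_Du f)
    then have "continuous_on (UNIV \<times> {0..1}) (\<lambda>y. Du (Du f) (?p (fst y) (snd y)))"
      by (rule continuous_on_compose2) (auto intro!: continuous_intros)
    then show "continuous_on (UNIV \<times> {0..1}) (\<lambda>(x, t). ?D2 (?p x t) a b)"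
      by (auto simp: case_prod_unfold intro!: continuous_intros)
  qed auto
  then show ?thesis
    by simp
qed

lemma hessian_symmetric:
  fixes f :: "real ^ 'n \<Rightarrow> real"
  assumes "smooth_on UNIV f"
  shows "a \<bullet> (Du (Du f) u *v b) = b \<bullet> (Du (Du f) u *v a)"
proof -
  let ?H = "Du (Du f) u"
  have "(\<Sum>i\<in>UNIV. a $ i *\<^sub>R (\<Sum>j\<in>UNIV. b $ j *\<^sub>R ?H $ j) $ i) = b \<bullet> (?H *v a)" for a b
  proof -
    have "(\<Sum>i\<in>UNIV. a $ i *\<^sub>R (\<Sum>j\<in>UNIV. b $ j *\<^sub>R ?H $ j) $ i) =
        (\<Sum>i\<in>UNIV. \<Sum>j\<in>UNIV. b $ j * (?H $ j $ i * a $ i))"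
      by (simp add: sum_component sum_distrib_left mult_ac)
    also have "\<dots> = (\<Sum>j\<in>UNIV. \<Sum>i\<in>UNIV. b $ j * (?H $ j $ i * a $ i))"
      by (rule sum.swap)
    also have "\<dots> = b \<bullet> (?H *v a)"
      by (simp add: inner_vec_def matrix_vector_mult_def sum_distrib_left)
    finally show ?thesis .
  qed
  then show ?thesis
    using Du_Du_commute[OF assms, of a b u] by simp
qed

lemma sum_scaleR_eq_vector_matrix_mult:
  fixes P :: "real ^ 'n ^ 'm"
  shows "(\<Sum>j\<in>UNIV. h $ j *\<^sub>R P $ j) = h v* P"
  by (simp add: vec_eq_iff vector_matrix_mult_def sum_component mult.commute)

text \<open>With the array convention of \<open>Du\<close> the derivative is naturally
  \<open>h v* Du (Du f) u\<close>; symmetry permits the column form.\<close>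

lemma has_derivative_hessian:
  fixes f :: "real ^ 'n \<Rightarrow> real"
  assumes f: "smooth_on UNIV f"
  shows "(Du f has_derivative (\<lambda>h. Du (Du f) u *v h)) (at u)"
proof -
  have "h v* Du (Du f) u = Du (Du f) u *v h" for h
  proof (rule vector_eq_rdot[THEN iffD1], intro allI)
    show "(h v* Du (Du f) u) \<bullet> a = (Du (Du f) u *v h) \<bullet> a" for a
      using hessian_symmetric[OF f, of h u a] dot_lmul_matrix[of h "Du (Du f) u" a]
      by (simp add: inner_commute)
  qed
  then show ?thesis
    using has_derivative_Du[OF smooth_on_Du[OF f], of u]
    by (simp add: sum_scaleR_eq_vector_matrix_mult)
qed

text \<open>Differentiating the compatibility relation in direction \<open>a\<close> writes the
  Hessian of \<open>q\<close> as a contraction of the second derivative of \<open>F\<close> with the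
  gradient of \<open>\<eta>\<close>, plus the product of the Hessian of \<open>\<eta>\<close> with
  the Jacobian. The first two are symmetric in \<open>a\<close> and \<open>b\<close>, hence so is
  the third.\<close>

lemma entropy_hessian_jacobian_symmetric:
  fixes F :: "real ^ 'n \<Rightarrow> real ^ 'n" and \<eta> q :: "real ^ 'n \<Rightarrow> real"
  assumes F: "smooth_on UNIV F" and \<eta>: "smooth_on UNIV \<eta>" and q: "smooth_on UNIV q"
    and flux: "\<And>u. Du \<eta> u v* jacobian F (at u) = Du q u"
  shows "(Du (Du \<eta>) u *v a) \<bullet> (jacobian F (at u) *v b) =
    (Du (Du \<eta>) u *v b) \<bullet> (jacobian F (at u) *v a)"
proof -
  let ?D2 = "\<lambda>h k. \<Sum>i\<in>UNIV. h $ i *\<^sub>R (\<Sum>j\<in>UNIV. k $ j *\<^sub>R Du (Du F) u $ j) $ i"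
  let ?J = "\<lambda>u h. jacobian F (at u) *v h"
  have key: "b \<bullet> (Du (Du q) u *v a) = Du \<eta> u \<bullet> ?D2 b a + (Du (Du \<eta>) u *v a) \<bullet> ?J u b" for a b
  proof -
    have "((\<lambda>u. Du q u \<bullet> b) has_derivative (\<lambda>h. (Du (Du q) u *v h) \<bullet> b)) (at u)"
      by (auto intro!: derivative_eq_intros has_derivative_hessian q)
    moreover have "((\<lambda>u. ?J u b) has_derivative (\<lambda>h. ?D2 b h)) (at u)"
      unfolding jacobian_mult_eq_sum_Du[OF F]
      by (intro has_derivative_sum has_derivative_scaleR_right
          bounded_linear.has_derivative[OF bounded_linear_vec_nth]
          has_derivative_Du[OF smooth_on_Du[OF F]])
    then have "((\<lambda>u. Du \<eta> u \<bullet> ?J u b) has_derivative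
        (\<lambda>h. Du \<eta> u \<bullet> ?D2 b h + (Du (Du \<eta>) u *v h) \<bullet> ?J u b)) (at u)"
      by (intro has_derivative_inner has_derivative_hessian \<eta>)
    moreover have "Du \<eta> u \<bullet> ?J u b = Du q u \<bullet> b" for u
      by (simp add: flux[symmetric] dot_lmul_matrix)
    ultimately have "(\<lambda>h. (Du (Du q) u *v h) \<bullet> b) =
        (\<lambda>h. Du \<eta> u \<bullet> ?D2 b h + (Du (Du \<eta>) u *v h) \<bullet> ?J u b)"
      by (simp add: has_derivative_unique)
    from fun_cong[OF this, of a] show ?thesis
      by (simp add: inner_commute)
  qed
  show ?thesis
    using key[of a b] key[of b a] hessian_symmetric[OF q, of a u b] Du_Du_commute[OF F, of a b u]
    by simp
qed

lemma taylor_hessian: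
  fixes f :: "real ^ 'n \<Rightarrow> real"
  assumes f: "smooth_on UNIV f"
  obtains \<xi> where "f y - f z - Du f z \<bullet> (y - z) = (1 / 2) * ((y - z) \<bullet> (Du (Du f) \<xi> *v (y - z)))"
proof -
  define w where "w = y - z"
  let ?p = "\<lambda>s. z + s *\<^sub>R w"
  \<comment> \<open>Successive derivatives of \<open>f\<close> along the segment; the expansion
    stops at order two, so the last branch stands for the second derivative.\<close>
  define diff where "diff = (\<lambda>m::nat. if m = 0 then (\<lambda>s. f (?p s))
    else if m = 1 then (\<lambda>s. Du f (?p s) \<bullet> w) else (\<lambda>s. (Du (Du f) (?p s) *v w) \<bullet> w))"
  have p: "(?p has_derivative (\<lambda>h. h *\<^sub>R w)) (at s)" for s
    by (auto intro!: derivative_eq_intros)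
  have "(diff 0 has_real_derivative diff 1 s) (at s)" for s
    using has_derivative_compose[OF p has_derivative_gradient[OF f]]
    by (simp add: diff_def has_field_derivative_def mult_commute_abs)
  moreover have "(diff 1 has_real_derivative diff 2 s) (at s)" for s
    using has_derivative_inner_left[OF has_derivative_compose[OF p has_derivative_hessian[OF f]], of w]
    by (simp add: diff_def has_field_derivative_def mult_commute_abs matrix_vector_mult_scaleR)
  ultimately have "\<forall>m t. m < 2 \<and> 0 \<le> t \<and> t \<le> 1 \<longrightarrow> (diff m has_real_derivative diff (Suc m) t) (at t)"
    by (simp add: numeral_2_eq_2 less_Suc_eq all_conj_distrib) metis
  from Taylor_up[OF _ _ this, of "diff 0" 0]
  obtain s where "diff 0 1 = diff 0 0 + diff 1 0 + diff 2 s / 2"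
    by (auto simp: numeral_2_eq_2)
  then have "f y - f z - Du f z \<bullet> w = (1 / 2) * (w \<bullet> (Du (Du f) (?p s) *v w))"
    by (simp add: diff_def w_def inner_commute)
  then show ?thesis
    using that unfolding w_def by blast
qed

subsection \<open>Integration of divergence inequalities\<close>

text \<open>Integrating \<open>a\<^sub>t + f\<^sub>x \<le> h\<close> over \<open>[-X, X] \<times> [0, T]\<close> and letting \<open>X\<close> tend to infinity.\<close>

lemma integral_le_of_divergence_le:
  fixes a at' f fx :: "real \<Rightarrow> real \<Rightarrow> real" and h :: "real \<Rightarrow> real"
  assumes T: "0 \<le> T"
    and a: "\<And>x t. t \<in> {0..T} \<Longrightarrow> ((\<lambda>t. a x t) has_vector_derivative at' x t) (at t within {0..T})"
    and cont: "continuous_on (UNIV \<times> {0..T}) (\<lambda>p. at' (fst p) (snd p))"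
    and f: "\<And>x t. t \<in> {0..T} \<Longrightarrow> ((\<lambda>x. f x t) has_vector_derivative fx x t) (at x)"
    and le: "\<And>x t. t \<in> {0..T} \<Longrightarrow> at' x t + fx x t \<le> h x"
    and h: "integrable lborel h"
    and f0: "\<And>\<delta>. 0 < \<delta> \<Longrightarrow> \<forall>\<^sub>F x in at_infinity. \<forall>t\<in>{0..T}. \<bar>f x t\<bar> \<le> \<delta>"
    and a0: "integrable lborel (\<lambda>x. a x 0)" and aT: "integrable lborel (\<lambda>x. a x T)"
  shows "(LINT x|lborel. a x T) \<le> (LINT x|lborel. a x 0) + T * (LINT x|lborel. h x)"
proof -
  have int_on: "g integrable_on {-X..X}"
    and int_eq: "integral {-X..X} g = (LINT x:{-X..X}|lborel. g x)"
    if "integrable lborel g" for g :: "real \<Rightarrow> real" and X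
  proof -
    have "set_integrable lborel {-X..X} g"
      using that by (intro integrable_mult_indicator[of _ lborel g, folded set_integrable_def]) auto
    then show "g integrable_on {-X..X}" "integral {-X..X} g = (LINT x:{-X..X}|lborel. g x)"
      by (simp_all add: set_borel_integral_eq_integral)
  qed
  have lim: "((\<lambda>X. integral {-X..X} g) \<longlongrightarrow> (LINT x|lborel. g x)) at_top"
    if "integrable lborel g" for g :: "real \<Rightarrow> real"
    unfolding int_eq[OF that] set_lebesgue_integral_def
  proof (rule integral_dominated_convergence_at_top)
    show "integrable lborel (\<lambda>x. norm (g x))"
      using that by simp
    show "\<forall>\<^sub>F X in at_top. AE x in lborel. norm (indicator {-X..X} x *\<^sub>R g x) \<le> norm (g x)"
      by (auto simp: indicator_def)
    show "AE x in lborel. ((\<lambda>X. indicator {-X..X} x *\<^sub>R g x) \<longlongrightarrow> g x) at_top"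
    proof (rule AE_I2, rule tendsto_eventually)
      show "\<forall>\<^sub>F X in at_top. indicator {-X..X} x *\<^sub>R g x = g x" for x
        using eventually_ge_at_top[of "\<bar>x\<bar>"] by eventually_elim (auto simp: indicator_def)
    qed
  qed (use that in auto)
  have bound: "integral {-X..X} (\<lambda>x. a x T) \<le>
      integral {-X..X} (\<lambda>x. a x 0) + T * integral {-X..X} h + 2 * T * \<delta>"
    if X: "0 \<le> X" and \<delta>: "\<forall>t\<in>{0..T}. \<bar>f X t\<bar> \<le> \<delta>" "\<forall>t\<in>{0..T}. \<bar>f (-X) t\<bar> \<le> \<delta>" for X \<delta>
  proof -
    have c2: "continuous_on (cbox (-X, 0) (X, T)) (\<lambda>(x, t). at' x t)"
      using continuous_on_subset[OF cont, of "cbox (-X, 0) (X, T)"]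
      by (auto simp: case_prod_unfold cbox_Pair_eq)
    have at_x: "((\<lambda>t. at' x t) has_integral a x T - a x 0) {0..T}" for x
      using T a by (intro fundamental_theorem_of_calculus) auto
    \<comment> \<open>Only \<open>at'\<close> is integrated over the box, where its continuity
      allows the order to be exchanged. The flux is integrated in \<open>x\<close> at fixed
      \<open>t\<close>, so it enters through its two boundary values alone.\<close>
    have f_int: "((\<lambda>x. fx x t) has_integral f X t - f (-X) t) {-X..X}" if "t \<in> {0..T}" for t
      using X f that
      by (intro fundamental_theorem_of_calculus) (auto intro: has_vector_derivative_at_within)
    have "integral {-X..X} (\<lambda>x. a x T) - integral {-X..X} (\<lambda>x. a x 0) =
        integral {-X..X} (\<lambda>x. a x T - a x 0)"
      by (rule integral_diff[symmetric]) (intro int_on a0 aT)+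
    also have "\<dots> = integral {-X..X} (\<lambda>x. integral {0..T} (at' x))"
      by (simp add: integral_unique[OF at_x])
    also have "\<dots> = integral {0..T} (\<lambda>t. integral {-X..X} (\<lambda>x. at' x t))"
      using integral_swap_continuous[OF c2] by simp
    also have "\<dots> \<le> integral {0..T} (\<lambda>t. integral {-X..X} h + 2 * \<delta>)"
    proof (rule integral_le)
      have "continuous_on ({0..T} \<times> cbox (-X) X) (\<lambda>(t, x). at' x t)"
        using continuous_on_compose2[OF cont, of "{0..T} \<times> cbox (-X) X" "\<lambda>(t, x). (x, t)"]
        by (force simp: case_prod_unfold intro!: continuous_intros)
      from integral_continuous_on_param[OF this]
      have "continuous_on {0..T} (\<lambda>t. integral {-X..X} (\<lambda>x. at' x t))"
        by simp
      then show "(\<lambda>t. integral {-X..X} (\<lambda>x. at' x t)) integrable_on {0..T}"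
        by (rule integrable_continuous_interval)
      show "integral {-X..X} (\<lambda>x. at' x t) \<le> integral {-X..X} h + 2 * \<delta>" if t: "t \<in> {0..T}" for t
      proof -
        have "continuous_on {-X..X} (\<lambda>x. at' x t)"
          using continuous_on_compose2[OF cont, of "{-X..X}" "\<lambda>x. (x, t)"] t
          by (force intro!: continuous_intros)
        then have "(\<lambda>x. at' x t) integrable_on {-X..X}"
          by (rule integrable_continuous_interval)
        moreover have "(\<lambda>x. h x - fx x t) integrable_on {-X..X}"
          using f_int[OF t] int_on[OF h] by (intro integrable_diff) (auto simp: integrable_on_def)
        ultimately have "integral {-X..X} (\<lambda>x. at' x t) \<le> integral {-X..X} (\<lambda>x. h x - fx x t)"
          using le[OF t] by (intro integral_le) (auto simp: algebra_simps)
        also have "\<dots> = integral {-X..X} h - (f X t - f (-X) t)"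
          using f_int[OF t] int_on[OF h]
          by (subst integral_diff) (auto simp: integral_unique)
        also have "\<dots> \<le> integral {-X..X} h + 2 * \<delta>"
          using \<delta> t by (smt (verit))
        finally show ?thesis .
      qed
    qed auto
    also have "\<dots> = T * integral {-X..X} h + 2 * T * \<delta>"
      using T by (simp add: algebra_simps)
    finally show ?thesis
      by simp
  qed
  \<comment> \<open>The boundary flux costs at most \<open>2 * T * \<delta>\<close> once
    \<open>X\<close> is large. First \<open>X\<close> tends to infinity for fixed
    \<open>\<delta>\<close>, then \<open>\<delta>\<close> tends to 0.\<close>
  have le\<delta>: "(LINT x|lborel. a x T) \<le> (LINT x|lborel. a x 0) + T * (LINT x|lborel. h x) + 2 * T * \<delta>"
    if "0 < \<delta>" for \<delta>
  proof (rule tendsto_le)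
    show "((\<lambda>X. integral {-X..X} (\<lambda>x. a x T)) \<longlongrightarrow> (LINT x|lborel. a x T)) at_top"
      by (rule lim[OF aT])
    show "((\<lambda>X. integral {-X..X} (\<lambda>x. a x 0) + T * integral {-X..X} h + 2 * T * \<delta>) \<longlongrightarrow>
        (LINT x|lborel. a x 0) + T * (LINT x|lborel. h x) + 2 * T * \<delta>) at_top"
      by (intro tendsto_intros lim a0 h)
    have "\<forall>\<^sub>F x in at_top. \<forall>t\<in>{0..T}. \<bar>f x t\<bar> \<le> \<delta>" "\<forall>\<^sub>F x in at_bot. \<forall>t\<in>{0..T}. \<bar>f x t\<bar> \<le> \<delta>"
      using f0[OF that] by (auto simp: at_infinity_eq_at_top_bot eventually_sup)
    then have "\<forall>\<^sub>F x in at_top. \<forall>t\<in>{0..T}. \<bar>f x t\<bar> \<le> \<delta>" "\<forall>\<^sub>F x in at_top. \<forall>t\<in>{0..T}. \<bar>f (-x) t\<bar> \<le> \<delta>"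
      by (auto simp: at_bot_mirror eventually_filtermap)
    then show "\<forall>\<^sub>F X in at_top. integral {-X..X} (\<lambda>x. a x T) \<le>
        integral {-X..X} (\<lambda>x. a x 0) + T * integral {-X..X} h + 2 * T * \<delta>"
      using eventually_ge_at_top[of 0] by eventually_elim (rule bound)
  qed simp
  show ?thesis
  proof (rule tendsto_lowerbound[where F = "at_right 0"])
    show "((\<lambda>\<delta>. (LINT x|lborel. a x 0) + T * (LINT x|lborel. h x) + 2 * T * \<delta>) \<longlongrightarrow>
        (LINT x|lborel. a x 0) + T * (LINT x|lborel. h x)) (at_right 0)"
      by (auto intro!: tendsto_eq_intros)
    show "\<forall>\<^sub>F \<delta> in at_right 0. (LINT x|lborel. a x T) \<le>
        (LINT x|lborel. a x 0) + T * (LINT x|lborel. h x) + 2 * T * \<delta>"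
      using le\<delta> by (auto simp: eventually_at_right_field intro: exI[of _ 1])
  qed simp
qed

section \<open>Auxiliary facts: coercivity, chain rules, consequences of decay\<close>

lemma sym_pos_def_coercive:
  fixes A :: "real ^ 'n ^ 'n"
  assumes "sym_pos_def A"
  obtains a where "0 < a" "\<And>x. a * (norm x)\<^sup>2 \<le> x \<bullet> (A *v x)"
proof -
  let ?S = "sphere (0 :: real ^ 'n) 1"
  have "continuous_on ?S (\<lambda>x. x \<bullet> (A *v x))"
    by (intro continuous_on_inner continuous_on_id linear_continuous_on matrix_vector_mul_bounded_linear)
  moreover have "compact ?S" "?S \<noteq> {}"
    by auto
  ultimately obtain x0 where x0: "x0 \<in> ?S" and min: "\<And>x. x \<in> ?S \<Longrightarrow> x0 \<bullet> (A *v x0) \<le> x \<bullet> (A *v x)"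
    by (meson continuous_attains_inf)
  show ?thesis
  proof (rule that)
    have "x0 \<noteq> 0"
      using x0 by auto
    then show "0 < x0 \<bullet> (A *v x0)"
      using assms unfolding sym_pos_def_def by blast
    show "x0 \<bullet> (A *v x0) * (norm x)\<^sup>2 \<le> x \<bullet> (A *v x)" for x
    proof (cases "x = 0")
      case False
      have "x0 \<bullet> (A *v x0) \<le> (x /\<^sub>R norm x) \<bullet> (A *v (x /\<^sub>R norm x))"
        using False by (intro min) simp
      also have "\<dots> = x \<bullet> (A *v x) / (norm x)\<^sup>2"
        by (simp add: matrix_vector_mult_scaleR power2_eq_square divide_inverse mult_ac)
      finally show ?thesis
        using False by (simp add: pos_le_divide_eq)
    qed simp
  qed
qed

lemma has_vector_derivative_compose:
  assumes "(y has_vector_derivative y') (at s within S)" "(f has_derivative f') (at (y s))"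
  shows "((\<lambda>s. f (y s)) has_vector_derivative f' y') (at s within S)"
proof -
  have "f' (h *\<^sub>R y') = h *\<^sub>R f' y'" for h
    using has_derivative_linear[OF assms(2)] by (simp add: linear_scale)
  then show ?thesis
    using has_derivative_compose[OF assms(1)[unfolded has_vector_derivative_def] assms(2)]
    by (simp add: has_vector_derivative_def)
qed

lemma has_vector_derivative_inner:
  assumes "(f has_vector_derivative f') (at s within S)" "(g has_vector_derivative g') (at s within S)"
  shows "((\<lambda>s. f s \<bullet> g s) has_vector_derivative f s \<bullet> g' + f' \<bullet> g s) (at s within S)"
  by (rule bounded_bilinear.has_vector_derivative[OF bounded_bilinear_inner assms])

lemma decays_fastE:
  assumes "decays_fast T u"
  obtains g where "(g \<longlongrightarrow> 0) at_infinity" "integrable lborel (\<lambda>x. (g x)\<^sup>2)"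
    "\<And>x t. t \<in> {0..T} \<Longrightarrow> norm (u x t) \<le> g x"
    "\<And>x t. t \<in> {0..T} \<Longrightarrow> norm (Dx u x t) \<le> g x"
    "\<And>x t. t \<in> {0..T} \<Longrightarrow> norm (Dt T u x t) \<le> g x"
    "\<And>x t. t \<in> {0..T} \<Longrightarrow> norm (Dx (Dx u) x t) \<le> g x"
    "\<And>x t. t \<in> {0..T} \<Longrightarrow> norm (Dt T (Dt T u) x t) \<le> g x"
proof -
  obtain g :: "real \<Rightarrow> real" where g: "(g \<longlongrightarrow> 0) at_infinity" "integrable lborel (\<lambda>x. (g x)\<^sup>2)"
    and bound: "\<And>k l x t. t \<in> {0..T} \<Longrightarrow> k + l \<le> 2 \<Longrightarrow> norm ((Dx ^^ k) ((Dt T ^^ l) u) x t) \<le> g x"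
    using assms unfolding decays_fast_def by blast
  show ?thesis
  proof (rule that[OF g])
    fix x t assume t: "t \<in> {0..T}"
    show "norm (u x t) \<le> g x" "norm (Dx u x t) \<le> g x" "norm (Dt T u x t) \<le> g x"
      "norm (Dx (Dx u) x t) \<le> g x" "norm (Dt T (Dt T u) x t) \<le> g x"
      using bound[OF t, of 0 0 x] bound[OF t, of 1 0 x] bound[OF t, of 0 1 x]
        bound[OF t, of 2 0 x] bound[OF t, of 0 2 x]
      by (simp_all add: numeral_2_eq_2)
  qed
qed

text \<open>The rate \<open>g\<close> may be unbounded near finite points, so it gives a bound only
  for large \<open>x\<close>; on the remaining compact box continuity takes over.\<close>

lemma bounded_of_decay:
  fixes f :: "real \<Rightarrow> real \<Rightarrow> 'a::real_normed_vector"
  assumes cont: "continuous_on (UNIV \<times> {0..T}) (\<lambda>p. f (fst p) (snd p))"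
    and g: "(g \<longlongrightarrow> 0) at_infinity" and fg: "\<And>x t. t \<in> {0..T} \<Longrightarrow> norm (f x t) \<le> g x"
  obtains B where "\<And>x t. t \<in> {0..T} \<Longrightarrow> norm (f x t) \<le> B"
proof -
  have "\<forall>\<^sub>F x in at_infinity. g x < 1"
    using g by (rule order_tendstoD) simp
  then obtain b where b: "\<And>x. b \<le> norm x \<Longrightarrow> g x < 1"
    by (auto simp: eventually_at_infinity)
  have "compact ((\<lambda>p. f (fst p) (snd p)) ` ({-b..b} \<times> {0..T}))"
    by (intro compact_continuous_image continuous_on_subset[OF cont] compact_Times) auto
  then obtain B where B: "\<And>x t. x \<in> {-b..b} \<Longrightarrow> t \<in> {0..T} \<Longrightarrow> norm (f x t) \<le> B"
    by (force dest!: compact_imp_bounded simp: bounded_iff)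
  show ?thesis
  proof (rule that)
    show "norm (f x t) \<le> max B 1" if t: "t \<in> {0..T}" for x t
    proof (cases "x \<in> {-b..b}")
      case True
      then show ?thesis
        using B[OF True t] by simp
    next
      case False
      then have "g x < 1"
        by (intro b) (auto simp: abs_if)
      then show ?thesis
        using fg[OF t, of x] by simp
    qed
  qed
qed

lemma integrable_of_bound:
  fixes f m :: "real \<Rightarrow> real"
  assumes "continuous_on UNIV f" "integrable lborel m" "\<And>x. 0 \<le> f x" "\<And>x. f x \<le> m x"
  shows "integrable lborel f"
proof (rule Bochner_Integration.integrable_bound[OF assms(2)])
  show "f \<in> borel_measurable lborel"
    using borel_measurable_continuous_onI[OF assms(1)] by simp
  show "AE x in lborel. norm (f x) \<le> norm (m x)"
    using order_trans[OF assms(4) abs_ge_self] assms(3) by simp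
qed

text \<open>The common shape of all error estimates: \<open>u\<close> and \<open>v\<close> are
  amplitudes whose product is controlled by the energy-like quantity \<open>S\<close>, while
  \<open>k\<close> and \<open>l\<close> collect the constants.\<close>

lemma inner_le_mult:
  fixes a b :: "'a::real_inner"
  assumes "norm a \<le> k * u" "norm b \<le> l * v" "u * v \<le> S" "0 \<le> k" "0 \<le> l"
  shows "a \<bullet> b \<le> k * l * S"
proof -
  have "a \<bullet> b \<le> norm a * norm b"
    by (rule norm_cauchy_schwarz)
  also have "\<dots> \<le> (k * u) * (l * v)"
    using assms(1,2) by (intro mult_mono) (auto intro: order_trans[OF norm_ge_zero])
  also have "\<dots> = k * l * (u * v)"
    by simp
  also have "\<dots> \<le> k * l * S"
    using assms(3-5) by (intro mult_left_mono) auto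
  finally show ?thesis .
qed

subsection \<open>Relative entropy\<close>

locale entropy_system =
  fixes F :: "real ^ 'n \<Rightarrow> real ^ 'n" and \<eta> q :: "real ^ 'n \<Rightarrow> real" and A :: "real ^ 'n ^ 'n"
    and \<alpha> \<beta> \<nu> M :: real
  assumes smooth: "smooth_on UNIV F" "smooth_on UNIV \<eta>" "smooth_on UNIV q"
    and A: "sym_pos_def A"
    and pos: "0 < \<alpha>" "0 < \<beta>" "0 < \<nu>" "0 < M"
    and entropy_flux: "\<And>u. Du \<eta> u v* jacobian F (at u) = Du q u"
    and hessian_bounds: "\<And>u. quad_le (mat \<beta>) (Du (Du \<eta>) u)" "\<And>u. quad_le (Du (Du \<eta>) u) (mat (\<alpha> / 2))"
    and subchar: "\<And>u. quad_le (mat \<nu>)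
           ((1 / 2) *\<^sub>R (A ** Du (Du \<eta>) u + Du (Du \<eta>) u ** A)
            - \<alpha> *\<^sub>R (transpose (jacobian F (at u)) ** jacobian F (at u)))"
    and third_bounds: "\<And>u. norm (Du (Du F) u) \<le> M" "\<And>u. norm (Du (Du (Du \<eta>)) u) \<le> M"
begin

abbreviation N :: "real ^ 'n \<Rightarrow> real ^ 'n" where "N \<equiv> Du \<eta>"
abbreviation H :: "real ^ 'n \<Rightarrow> real ^ 'n ^ 'n" where "H \<equiv> Du (Du \<eta>)"
abbreviation J :: "real ^ 'n \<Rightarrow> real ^ 'n ^ 'n" where "J u \<equiv> jacobian F (at u)"

definition rel_entropy :: "real ^ 'n \<Rightarrow> real ^ 'n \<Rightarrow> real" where
  "rel_entropy y z = \<eta> y - \<eta> z - N z \<bullet> (y - z)"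

lemma A_symmetric: "a \<bullet> (A *v b) = b \<bullet> (A *v a)"
  using A unfolding sym_pos_def_def
  by (metis dot_lmul_matrix inner_commute transpose_matrix_vector)

lemmas H_symmetric = hessian_symmetric[OF smooth(2)]

lemma H_J_symmetric: "(H u *v a) \<bullet> (J u *v b) = (H u *v b) \<bullet> (J u *v a)"
  by (rule entropy_hessian_jacobian_symmetric[OF smooth entropy_flux])

lemma rel_entropy_ge: "\<beta> / 2 * (norm (y - z))\<^sup>2 \<le> rel_entropy y z"
proof -
  obtain \<xi> where "rel_entropy y z = (1 / 2) * ((y - z) \<bullet> (H \<xi> *v (y - z)))"
    using taylor_hessian[OF smooth(2)] unfolding rel_entropy_def by metis
  then show ?thesis
    using hessian_bounds(1)[of \<xi>, unfolded quad_le_def, rule_format, of "y - z"]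
    by (simp add: power2_norm_eq_inner)
qed

lemma rel_entropy_le: "rel_entropy y z \<le> \<alpha> / 4 * (norm (y - z))\<^sup>2"
proof -
  obtain \<xi> where "rel_entropy y z = (1 / 2) * ((y - z) \<bullet> (H \<xi> *v (y - z)))"
    using taylor_hessian[OF smooth(2)] unfolding rel_entropy_def by metis
  then show ?thesis
    using hessian_bounds(2)[of \<xi>, unfolded quad_le_def, rule_format, of "y - z"]
    by (simp add: power2_norm_eq_inner)
qed

text \<open>A gradient step of length \<open>2 / \<alpha>\<close> from \<open>y\<close> cannot make the relative entropy negative.\<close>

lemma gradient_diff_le_rel_entropy: "(norm (N y - N z))\<^sup>2 \<le> \<alpha> * rel_entropy y z"
proof -
  define p where "p = N y - N z"
  \<comment> \<open>The step length \<open>2 / \<alpha>\<close> minimizes the quadratic majorant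
    \<open>\<alpha> / 4 * s^2 * |p|^2 - s * |p|^2\<close>, whose minimum is
    \<open>- |p|^2 / \<alpha>\<close>.\<close>
  define v where "v = y - (2 / \<alpha>) *\<^sub>R p"
  have vy: "v - y = - ((2 / \<alpha>) *\<^sub>R p)"
    by (simp add: v_def)
  have "0 \<le> rel_entropy v z"
    using rel_entropy_ge[of v z] pos by (smt (verit) mult_nonneg_nonneg divide_nonneg_nonneg zero_le_power2)
  \<comment> \<open>The three-point identity of Bregman distances.\<close>
  also have "\<dots> = rel_entropy v y + rel_entropy y z + p \<bullet> (v - y)"
    by (simp add: rel_entropy_def p_def inner_diff_left inner_diff_right)
  also have "\<dots> \<le> \<alpha> / 4 * (norm (v - y))\<^sup>2 + rel_entropy y z + p \<bullet> (v - y)"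
    using rel_entropy_le[of v y] by simp
  also have "\<dots> = rel_entropy y z - (norm p)\<^sup>2 / \<alpha>"
    using pos unfolding vy
    by (simp add: power_mult_distrib power2_norm_eq_inner[symmetric] field_simps power2_eq_square)
  finally show ?thesis
    using pos by (simp add: p_def field_simps)
qed

lemma norm_gradient_diff_le: "norm (N y - N z) \<le> \<alpha> * norm (y - z)"
proof -
  have "(norm (N y - N z))\<^sup>2 \<le> \<alpha> * (\<alpha> / 4 * (norm (y - z))\<^sup>2)"
    using gradient_diff_le_rel_entropy[of y z] mult_left_mono[OF rel_entropy_le[of y z], of \<alpha>] pos
    by linarith
  also have "\<dots> \<le> (\<alpha> * norm (y - z))\<^sup>2"
    using pos by (simp add: power_mult_distrib power2_eq_square)
  finally show ?thesis
    using pos by (simp add: power2_le_iff_abs_le)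
qed

lemma H_diff_le: "norm ((H y - H z) *v h) \<le> M * norm (y - z) * norm h"
proof -
  have "norm (H y - H z) \<le> M * norm (y - z)"
    by (rule norm_diff_le_of_Du_bound[OF smooth_on_Du[OF smooth_on_Du[OF smooth(2)]] third_bounds(2)])
  from order_trans[OF norm_matrix_vector_mult_le mult_right_mono[OF this norm_ge_zero]]
  show ?thesis .
qed

lemma J_diff_le: "norm ((J y - J z) *v h) \<le> M * norm (y - z) * norm h"
proof -
  have "norm (Du F y - Du F z) \<le> M * norm (y - z)"
    by (rule norm_diff_le_of_Du_bound[OF smooth_on_Du[OF smooth(1)] third_bounds(1)])
  from order_trans[OF norm_sum_scaleR_vec_le mult_right_mono[OF this norm_ge_zero]]
  have "norm (\<Sum>j\<in>UNIV. h $ j *\<^sub>R (Du F y - Du F z) $ j) \<le> M * norm (y - z) * norm h" .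
  then show ?thesis
    unfolding matrix_vector_mult_diff_rdistrib jacobian_mult_eq_sum_Du[OF smooth(1)]
    by (simp add: sum_subtractf scaleR_diff_right)
qed

lemma N_taylor: "norm (N y - N z - H z *v (y - z)) \<le> M * (norm (y - z))\<^sup>2"
  using taylor_le_of_Du_Du_bound[OF smooth_on_Du[OF smooth(2)] third_bounds(2), of y z]
  by (simp add: fun_cong[OF has_derivative_unique[OF has_derivative_hessian[OF smooth(2), of z]
        has_derivative_Du[OF smooth_on_Du[OF smooth(2)], of z]]])

lemma F_taylor: "norm (F y - F z - J z *v (y - z)) \<le> M * (norm (y - z))\<^sup>2"
  using taylor_le_of_Du_Du_bound[OF smooth(1) third_bounds(1), of y z]
  by (simp add: jacobian_mult_eq_sum_Du[OF smooth(1)])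

text \<open>The bound \<open>H \<le> \<alpha> / 2\<close> leaves half of
  \<open>\<alpha> |wt|^2\<close>. A quarter of \<open>\<alpha> |wt|^2\<close>, the cross term and
  the \<open>\<alpha> |J wx|^2\<close> supplied by the subcharacteristic condition form the square
  \<open>\<alpha> |wt / 2 + J wx|^2\<close>.\<close>

lemma dissipation_nonneg:
  "0 \<le> \<alpha> * (wt \<bullet> wt) - wt \<bullet> (H y *v wt) + (H y *v wx) \<bullet> (A *v wx) + \<alpha> * (wt \<bullet> (J y *v wx))"
proof -
  have "\<nu> * (wx \<bullet> wx) \<le> wx \<bullet> (((1 / 2) *\<^sub>R (A ** H y + H y ** A)
            - \<alpha> *\<^sub>R (transpose (J y) ** J y)) *v wx)"
    using subchar[of y, unfolded quad_le_def, rule_format, of wx] by simp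
  also have "\<dots> = (1 / 2) * (wx \<bullet> (A *v (H y *v wx)) + wx \<bullet> (H y *v (A *v wx))) -
      \<alpha> * (wx \<bullet> (transpose (J y) *v (J y *v wx)))"
    unfolding matrix_vector_mult_diff_rdistrib matrix_vector_mult_add_rdistrib
      scaleR_matrix_vector_assoc[symmetric] matrix_vector_mul_assoc[symmetric]
      inner_diff_right inner_add_right inner_scaleR_right ..
  \<comment> \<open>Both halves of the symmetrized product \<open>A H + H A\<close> have the same
    quadratic form, which is the one that integration by parts produces.\<close>
  also have "wx \<bullet> (A *v (H y *v wx)) = (H y *v wx) \<bullet> (A *v wx)"
    by (rule A_symmetric)
  also have "wx \<bullet> (H y *v (A *v wx)) = (H y *v wx) \<bullet> (A *v wx)"
    using H_symmetric[of wx y "A *v wx"] by (simp add: inner_commute)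
  also have "wx \<bullet> (transpose (J y) *v (J y *v wx)) = (J y *v wx) \<bullet> (J y *v wx)"
    by (simp add: dot_lmul_matrix inner_commute[of wx])
  finally have "\<nu> * (wx \<bullet> wx) \<le> (H y *v wx) \<bullet> (A *v wx) - \<alpha> * ((J y *v wx) \<bullet> (J y *v wx))"
    by simp
  moreover have "0 \<le> \<nu> * (wx \<bullet> wx)"
    using pos by simp
  moreover have "wt \<bullet> (H y *v wt) \<le> \<alpha> / 2 * (wt \<bullet> wt)"
    using hessian_bounds(2)[of y, unfolded quad_le_def, rule_format, of wt] by simp
  moreover have "0 \<le> \<alpha> * (wt \<bullet> wt)"
    using pos by simp
  moreover have "0 \<le> \<alpha> * ((1 / 4) * (wt \<bullet> wt) + wt \<bullet> (J y *v wx) + (J y *v wx) \<bullet> (J y *v wx))"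
  proof -
    have "(1 / 4) * (wt \<bullet> wt) + wt \<bullet> (J y *v wx) + (J y *v wx) \<bullet> (J y *v wx) =
        ((1 / 2) *\<^sub>R wt + J y *v wx) \<bullet> ((1 / 2) *\<^sub>R wt + J y *v wx)"
      by (simp add: inner_add_left inner_add_right inner_commute)
    also have "0 \<le> \<dots>"
      by (rule inner_ge_zero)
    finally show ?thesis
      using pos by simp
  qed
  ultimately show ?thesis
    by (simp add: algebra_simps)
qed

subsection \<open>Energy balance\<close>

definition energy where
  "energy \<epsilon> y z wt wx = rel_entropy y z + \<epsilon> * ((N y - N z) \<bullet> wt)
    + \<alpha> * \<epsilon>\<^sup>2 / 2 * (wt \<bullet> wt + wx \<bullet> (A *v wx))"

text \<open>The derivative of \<open>energy\<close> with the derivatives of its arguments as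
  independent vectors. Together with \<open>flux'\<close> this reduces the energy balance to algebra
  at a single point.\<close>

definition energy' where
  "energy' \<epsilon> y z wt wx y' z' wt' wx' =
    N y \<bullet> y' - N z \<bullet> z' - (N z \<bullet> (y' - z') + (H z *v z') \<bullet> (y - z))
    + \<epsilon> * ((N y - N z) \<bullet> wt' + (H y *v y' - H z *v z') \<bullet> wt)
    + \<alpha> * \<epsilon>\<^sup>2 * (wt \<bullet> wt' + wx' \<bullet> (A *v wx))"

text \<open>The first three terms are the relative entropy flux. The others are the boundary terms
  from integrating \<open>A wxx\<close> by parts against \<open>\<epsilon> p\<close> and
  \<open>\<alpha> \<epsilon>^2 wt\<close>.\<close>

definition flux where
  "flux \<epsilon> y z wt wx = q y - q z - N z \<bullet> (F y - F z) - \<epsilon> * ((N y - N z) \<bullet> (A *v wx))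
    - \<alpha> * \<epsilon>\<^sup>2 * (wt \<bullet> (A *v wx))"

definition flux' where
  "flux' \<epsilon> y z wt wx y' z' wt' wx' =
    N y \<bullet> (J y *v y') - N z \<bullet> (J z *v z')
    - (N z \<bullet> (J y *v y' - J z *v z') + (H z *v z') \<bullet> (F y - F z))
    - \<epsilon> * ((N y - N z) \<bullet> (A *v wx') + (H y *v y' - H z *v z') \<bullet> (A *v wx))
    - \<alpha> * \<epsilon>\<^sup>2 * (wt \<bullet> (A *v wx') + wt' \<bullet> (A *v wx))"

text \<open>The derivative of \<open>q\<close> is expressed through \<open>N\<close> and
  \<open>J\<close>; in this form the entropy compatibility enters the balance.\<close>

lemma has_vector_derivative_along:
  assumes "(y has_vector_derivative y') (at s within S)"
  shows "((\<lambda>s. \<eta> (y s)) has_vector_derivative N (y s) \<bullet> y') (at s within S)"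
    and "((\<lambda>s. N (y s)) has_vector_derivative H (y s) *v y') (at s within S)"
    and "((\<lambda>s. F (y s)) has_vector_derivative J (y s) *v y') (at s within S)"
    and "((\<lambda>s. q (y s)) has_vector_derivative N (y s) \<bullet> (J (y s) *v y')) (at s within S)"
    and "((\<lambda>s. A *v y s) has_vector_derivative A *v y') (at s within S)"
proof -
  show "((\<lambda>s. \<eta> (y s)) has_vector_derivative N (y s) \<bullet> y') (at s within S)"
    by (rule has_vector_derivative_compose[OF assms has_derivative_gradient[OF smooth(2)]])
  show "((\<lambda>s. N (y s)) has_vector_derivative H (y s) *v y') (at s within S)"
    by (rule has_vector_derivative_compose[OF assms has_derivative_hessian[OF smooth(2)]])
  show "((\<lambda>s. F (y s)) has_vector_derivative J (y s) *v y') (at s within S)"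
    by (rule has_vector_derivative_compose[OF assms has_derivative_jacobian[OF smooth(1)]])
  have "N (y s) \<bullet> (J (y s) *v y') = Du q (y s) \<bullet> y'"
    by (simp add: entropy_flux[symmetric] dot_lmul_matrix)
  then show "((\<lambda>s. q (y s)) has_vector_derivative N (y s) \<bullet> (J (y s) *v y')) (at s within S)"
    using has_vector_derivative_compose[OF assms has_derivative_gradient[OF smooth(3)]] by simp
  show "((\<lambda>s. A *v y s) has_vector_derivative A *v y') (at s within S)"
    by (rule bounded_linear.has_vector_derivative[OF matrix_vector_mul_bounded_linear assms])
qed

lemma has_vector_derivative_energy:
  assumes "(y has_vector_derivative y') (at s within S)" "(z has_vector_derivative z') (at s within S)"
    "(wt has_vector_derivative wt') (at s within S)" "(wx has_vector_derivative wx') (at s within S)"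
  shows "((\<lambda>s. energy \<epsilon> (y s) (z s) (wt s) (wx s)) has_vector_derivative
    energy' \<epsilon> (y s) (z s) (wt s) (wx s) y' z' wt' wx') (at s within S)"
proof -
  note D = assms has_vector_derivative_along(1,2)[OF assms(1)] has_vector_derivative_along(1,2)[OF assms(2)]
    has_vector_derivative_along(5)[OF assms(4)]
  have "wx s \<bullet> (A *v wx') = wx' \<bullet> (A *v wx s)"
    by (rule A_symmetric)
  then have eq: "\<alpha> * \<epsilon>\<^sup>2 / 2 * ((wt s \<bullet> wt' + wt' \<bullet> wt s) + (wx s \<bullet> (A *v wx') + wx' \<bullet> (A *v wx s)))
      = \<alpha> * \<epsilon>\<^sup>2 * (wt s \<bullet> wt' + wx' \<bullet> (A *v wx s))"
    by (simp add: inner_commute[of wt' "wt s"])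
  show ?thesis
    unfolding energy_def energy'_def rel_entropy_def eq[symmetric]
    by (intro has_vector_derivative_add has_vector_derivative_diff has_vector_derivative_inner
        has_vector_derivative_mult_right D)
qed

lemma has_vector_derivative_flux:
  assumes "(y has_vector_derivative y') (at s within S)" "(z has_vector_derivative z') (at s within S)"
    "(wt has_vector_derivative wt') (at s within S)" "(wx has_vector_derivative wx') (at s within S)"
  shows "((\<lambda>s. flux \<epsilon> (y s) (z s) (wt s) (wx s)) has_vector_derivative
    flux' \<epsilon> (y s) (z s) (wt s) (wx s) y' z' wt' wx') (at s within S)"
  unfolding flux_def flux'_def
  by (intro has_vector_derivative_diff has_vector_derivative_inner has_vector_derivative_mult_right
      has_vector_derivative_along[OF assms(1)] has_vector_derivative_along[OF assms(2)]
      has_vector_derivative_along(5)[OF assms(4)] assms)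

lemma continuous_on_N: "continuous_on S N" and continuous_on_H: "continuous_on S H"
  and continuous_on_\<eta>: "continuous_on S \<eta>" and continuous_on_q: "continuous_on S q"
  and continuous_on_F: "continuous_on S F"
  by (auto intro!: continuous_on_subset[OF smooth_on_imp_continuous_on subset_UNIV] smooth smooth_on_Du)

lemmas continuous_on_state =
  continuous_on_compose2[OF continuous_on_N[of UNIV]] continuous_on_compose2[OF continuous_on_H[of UNIV]]
  continuous_on_compose2[OF continuous_on_\<eta>[of UNIV]] continuous_on_compose2[OF continuous_on_q[of UNIV]]
  continuous_on_compose2[OF continuous_on_F[of UNIV]]

lemma continuous_on_matrix_vector_mult:
  fixes P :: "'a::topological_space \<Rightarrow> real ^ 'k ^ 'm"
  assumes "continuous_on S P" "continuous_on S f"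
  shows "continuous_on S (\<lambda>s. P s *v f s)"
  unfolding matrix_vector_mult_def by (intro continuous_intros assms)

lemma continuous_on_energy:
  assumes "continuous_on S y" "continuous_on S z" "continuous_on S wt" "continuous_on S wx"
  shows "continuous_on S (\<lambda>s. energy \<epsilon> (y s) (z s) (wt s) (wx s))"
  unfolding energy_def rel_entropy_def
  by (intro continuous_intros continuous_on_state continuous_on_matrix_vector_mult assms) auto

lemma continuous_on_flux:
  assumes "continuous_on S y" "continuous_on S z" "continuous_on S wt" "continuous_on S wx"
  shows "continuous_on S (\<lambda>s. flux \<epsilon> (y s) (z s) (wt s) (wx s))"
  unfolding flux_def
  by (intro continuous_intros continuous_on_state continuous_on_matrix_vector_mult assms) auto

lemma continuous_on_energy':
  assumes "continuous_on S y" "continuous_on S z" "continuous_on S wt" "continuous_on S wx"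
    "continuous_on S y'" "continuous_on S z'" "continuous_on S wt'" "continuous_on S wx'"
  shows "continuous_on S (\<lambda>s. energy' \<epsilon> (y s) (z s) (wt s) (wx s) (y' s) (z' s) (wt' s) (wx' s))"
  unfolding energy'_def
  by (intro continuous_intros continuous_on_state continuous_on_matrix_vector_mult assms) auto

section \<open>Equivalence of the energy with the integrand of \<open>Psi\<close>\<close>

definition energy_norm :: "real \<Rightarrow> real ^ 'n \<Rightarrow> real ^ 'n \<Rightarrow> real ^ 'n \<Rightarrow> real" where
  "energy_norm \<epsilon> w wx wt = (norm w)\<^sup>2 + \<epsilon>\<^sup>2 * (norm wx)\<^sup>2 + \<epsilon>\<^sup>2 * (norm wt)\<^sup>2"

text \<open>Only the cross term \<open>\<epsilon> * (p \<bullet> wt)\<close> is indefinite. It is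
  absorbed by 3/4 of the relative entropy and \<open>\<alpha> / 3 * \<epsilon>^2 * |wt|^2\<close>;
  any share strictly between 1/2 and 1 would do. This rests on
  \<open>|p|^2 \<le> \<alpha> * rel_entropy y z\<close>: the Lipschitz bound of \<open>N\<close>
  would give the factor \<open>\<alpha>^2 / (2 * \<beta>)\<close>, too large when
  \<open>\<beta>\<close> is small against \<open>\<alpha>\<close>.\<close>

lemma energy_ge:
  obtains c where "0 < c" "\<And>\<epsilon> y z wt wx. c * energy_norm \<epsilon> (y - z) wx wt \<le> energy \<epsilon> y z wt wx"
proof -
  obtain a where a: "0 < a" "\<And>x. a * (norm x)\<^sup>2 \<le> x \<bullet> (A *v x)"
    using sym_pos_def_coercive[OF A] by blast
  define c where "c = min (\<beta> / 8) (min (\<alpha> / 6) (\<alpha> * a / 2))"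
  have c: "0 < c" "c \<le> \<beta> / 8" "c \<le> \<alpha> / 6" "c \<le> \<alpha> * a / 2"
    using a pos by (auto simp: c_def)
  have "c * energy_norm \<epsilon> (y - z) wx wt \<le> energy \<epsilon> y z wt wx" for \<epsilon> y z wt wx
  proof -
    define p where "p = N y - N z"
    have "0 \<le> \<alpha> / 3 * (norm ((3 / (2 * \<alpha>)) *\<^sub>R p + \<epsilon> *\<^sub>R wt))\<^sup>2"
      using pos by simp
    also have "\<dots> = 3 / (4 * \<alpha>) * (norm p)\<^sup>2 + \<epsilon> * (p \<bullet> wt) + \<alpha> / 3 * \<epsilon>\<^sup>2 * (norm wt)\<^sup>2"
      unfolding power2_norm_eq_inner using pos
      by (simp add: inner_add_left inner_add_right inner_commute power2_eq_square field_simps)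
    also have "3 / (4 * \<alpha>) * (norm p)\<^sup>2 \<le> 3 / 4 * rel_entropy y z"
      using gradient_diff_le_rel_entropy[of y z] pos by (simp add: p_def field_simps)
    finally have "0 \<le> 3 / 4 * rel_entropy y z + \<epsilon> * (p \<bullet> wt) + \<alpha> / 3 * \<epsilon>\<^sup>2 * (norm wt)\<^sup>2"
      by simp
    moreover have "c * (norm (y - z))\<^sup>2 \<le> \<beta> / 8 * (norm (y - z))\<^sup>2"
      by (intro mult_right_mono c) simp
    moreover have "c * (\<epsilon>\<^sup>2 * (norm wt)\<^sup>2) \<le> \<alpha> / 6 * (\<epsilon>\<^sup>2 * (norm wt)\<^sup>2)"
      by (intro mult_right_mono c) simp
    moreover have "c * (\<epsilon>\<^sup>2 * (norm wx)\<^sup>2) \<le> \<alpha> * \<epsilon>\<^sup>2 / 2 * (wx \<bullet> (A *v wx))"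
    proof -
      have "c * (\<epsilon>\<^sup>2 * (norm wx)\<^sup>2) \<le> \<alpha> * a / 2 * (\<epsilon>\<^sup>2 * (norm wx)\<^sup>2)"
        by (intro mult_right_mono c) simp
      also have "\<dots> = \<alpha> * \<epsilon>\<^sup>2 / 2 * (a * (norm wx)\<^sup>2)"
        by simp
      also have "\<dots> \<le> \<alpha> * \<epsilon>\<^sup>2 / 2 * (wx \<bullet> (A *v wx))"
        using pos by (intro mult_left_mono a) simp
      finally show ?thesis .
    qed
    ultimately show ?thesis
      using rel_entropy_ge[of y z]
      unfolding energy_def energy_norm_def p_def[symmetric] power2_norm_eq_inner[of wt, symmetric]
      by (simp add: algebra_simps)
  qed
  with c(1) show ?thesis
    by (rule that)
qed

lemma energy_le:
  obtains C where "0 < C" "\<And>\<epsilon> y z wt wx. energy \<epsilon> y z wt wx \<le> C * energy_norm \<epsilon> (y - z) wx wt"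
proof -
  define C where "C = \<alpha> + \<alpha>\<^sup>2 + 1 + \<alpha> * norm A"
  have C: "0 < C" "\<alpha> / 4 + \<alpha>\<^sup>2 / 2 \<le> C" "1 / 2 + \<alpha> / 2 \<le> C" "\<alpha> / 2 * norm A \<le> C"
  proof -
    have "0 \<le> \<alpha> * norm A" "0 \<le> \<alpha>\<^sup>2"
      using pos by simp_all
    then show "0 < C" "\<alpha> / 4 + \<alpha>\<^sup>2 / 2 \<le> C" "1 / 2 + \<alpha> / 2 \<le> C" "\<alpha> / 2 * norm A \<le> C"
      using pos unfolding C_def by linarith+
  qed
  have "energy \<epsilon> y z wt wx \<le> C * energy_norm \<epsilon> (y - z) wx wt" for \<epsilon> y z wt wx
  proof -
    define p where "p = N y - N z"
    have "0 \<le> (norm (p - \<epsilon> *\<^sub>R wt))\<^sup>2"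
      by simp
    then have "\<epsilon> * (p \<bullet> wt) \<le> (norm p)\<^sup>2 / 2 + \<epsilon>\<^sup>2 * (norm wt)\<^sup>2 / 2"
      unfolding power2_norm_eq_inner
      by (simp add: inner_diff_left inner_diff_right inner_commute power2_eq_square)
    moreover have "(norm p)\<^sup>2 \<le> \<alpha>\<^sup>2 * (norm (y - z))\<^sup>2"
      using power_mono[OF norm_gradient_diff_le[of y z] norm_ge_zero, of 2]
      by (simp add: p_def power_mult_distrib)
    moreover have "(\<alpha> / 4 + \<alpha>\<^sup>2 / 2) * (norm (y - z))\<^sup>2 \<le> C * (norm (y - z))\<^sup>2"
      by (intro mult_right_mono C) simp
    moreover have "(1 / 2 + \<alpha> / 2) * (\<epsilon>\<^sup>2 * (norm wt)\<^sup>2) \<le> C * (\<epsilon>\<^sup>2 * (norm wt)\<^sup>2)"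
      by (intro mult_right_mono C) simp
    moreover have "\<alpha> * \<epsilon>\<^sup>2 / 2 * (wx \<bullet> (A *v wx)) \<le> C * (\<epsilon>\<^sup>2 * (norm wx)\<^sup>2)"
    proof -
      have "wx \<bullet> (A *v wx) \<le> norm wx * (norm A * norm wx)"
        by (intro order_trans[OF norm_cauchy_schwarz] mult_left_mono norm_matrix_vector_mult_le) simp
      then have "\<alpha> * \<epsilon>\<^sup>2 / 2 * (wx \<bullet> (A *v wx)) \<le> \<alpha> * \<epsilon>\<^sup>2 / 2 * (norm wx * (norm A * norm wx))"
        using pos by (intro mult_left_mono) auto
      also have "\<dots> = \<alpha> / 2 * norm A * (\<epsilon>\<^sup>2 * (norm wx)\<^sup>2)"
        by (simp add: power2_eq_square)
      also have "\<dots> \<le> C * (\<epsilon>\<^sup>2 * (norm wx)\<^sup>2)"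
        by (intro mult_right_mono C) simp
      finally show ?thesis .
    qed
    ultimately show ?thesis
      using rel_entropy_le[of y z]
      unfolding energy_def energy_norm_def p_def[symmetric] power2_norm_eq_inner[of wt, symmetric]
      by (simp add: algebra_simps)
  qed
  with C(1) show ?thesis
    by (rule that)
qed

text \<open>
  The first line is the dissipation. The terms linear in \<open>w\<close> have cancelled: the symmetry of the
  Hessian \<open>H\<close> and of \<open>H J\<close> turns them into the Taylor remainders of \<open>N\<close> and \<open>F\<close>.
\<close>

lemma production_eq:
  assumes z: "zt + J z *v zx = Gz"
    and y: "(zt + wt) + J y *v (zx + wx) = (Gz + d) + \<epsilon> *\<^sub>R (A *v wxx - wtt + R)"
  shows "energy' \<epsilon> y z wt wx (zt + wt) zt wtt wxt + flux' \<epsilon> y z wt wx (zx + wx) zx wxt wxx =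
    - \<epsilon> * (\<alpha> * (wt \<bullet> wt) - wt \<bullet> (H y *v wt) + (H y *v wx) \<bullet> (A *v wx) + \<alpha> * (wt \<bullet> (J y *v wx)))
    + (N y - N z) \<bullet> d + (N y - N z) \<bullet> (\<epsilon> *\<^sub>R R)
    + (N y - N z - H z *v (y - z)) \<bullet> Gz + (F y - F z - J z *v (y - z)) \<bullet> - (H z *v zx)
    + ((H y - H z) *v zt) \<bullet> (\<epsilon> *\<^sub>R wt) + ((H y - H z) *v zx) \<bullet> - (\<epsilon> *\<^sub>R (A *v wx))
    + d \<bullet> (\<alpha> *\<^sub>R \<epsilon> *\<^sub>R wt) + (\<epsilon> *\<^sub>R R) \<bullet> (\<alpha> *\<^sub>R \<epsilon> *\<^sub>R wt)
    + ((J y - J z) *v zx) \<bullet> - (\<alpha> *\<^sub>R \<epsilon> *\<^sub>R wt)"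
proof -
  define w p dF where "w = y - z" and "p = N y - N z" and "dF = F y - F z"
  \<comment> \<open>Second derivatives enter the balance only through \<open>p \<bullet> X\<close>
    and \<open>\<alpha> * \<epsilon> * (wt \<bullet> X)\<close>: the two contributions of
    \<open>wxt\<close> cancel. The equation then eliminates \<open>X\<close>.\<close>
  define X where "X = \<epsilon> *\<^sub>R (wtt - A *v wxx)"
  note expand = inner_add_left inner_add_right inner_diff_left inner_diff_right
    matrix_vector_right_distrib matrix_vector_mult_diff_rdistrib
  have X: "X = d + \<epsilon> *\<^sub>R R - wt - J y *v wx - (J y - J z) *v zx"
    using y unfolding z[symmetric] X_def by (simp add: expand algebra_simps)
  have eq: "energy' \<epsilon> y z wt wx (zt + wt) zt wtt wxt + flux' \<epsilon> y z wt wx (zx + wx) zx wxt wxx =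
      p \<bullet> (wt + zt + J y *v (wx + zx)) - (H z *v zt) \<bullet> w - (H z *v zx) \<bullet> dF
      + \<epsilon> * ((H y *v wt + (H y - H z) *v zt) \<bullet> wt) - \<epsilon> * ((H y *v wx + (H y - H z) *v zx) \<bullet> (A *v wx))
      + p \<bullet> X + \<alpha> * \<epsilon> * (wt \<bullet> X)"
    unfolding energy'_def flux'_def w_def[symmetric] p_def[symmetric] dF_def[symmetric] X_def
    by (simp add: expand p_def power2_eq_square algebra_simps)
  \<comment> \<open>The equation for \<open>y\<close> tested with \<open>p\<close>.\<close>
  have p: "p \<bullet> (wt + zt + J y *v (wx + zx)) + p \<bullet> X = p \<bullet> Gz + p \<bullet> d + p \<bullet> (\<epsilon> *\<^sub>R R)"
    unfolding X z[symmetric] by (simp add: expand)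
  have wt: "\<alpha> * \<epsilon> * (wt \<bullet> X) = d \<bullet> (\<alpha> *\<^sub>R \<epsilon> *\<^sub>R wt) + (\<epsilon> *\<^sub>R R) \<bullet> (\<alpha> *\<^sub>R \<epsilon> *\<^sub>R wt)
      + ((J y - J z) *v zx) \<bullet> - (\<alpha> *\<^sub>R \<epsilon> *\<^sub>R wt)
      - \<epsilon> * (\<alpha> * (wt \<bullet> wt)) - \<epsilon> * (\<alpha> * (wt \<bullet> (J y *v wx)))"
    unfolding X by (simp add: expand inner_commute algebra_simps)
  \<comment> \<open>Splitting \<open>Gz\<close> by the balance law, the linear part
    \<open>(H z *v w) \<bullet> Gz\<close> consists of these two products. The symmetries move
    \<open>w\<close> to the other factor, where it matches the linear parts of the terms with
    \<open>w\<close> and \<open>dF\<close> in \<open>eq\<close>.\<close>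
  have "(H z *v w) \<bullet> zt = (H z *v zt) \<bullet> w"
    using H_symmetric[of zt z w] by (simp add: inner_commute)
  moreover have "(H z *v w) \<bullet> (J z *v zx) = (H z *v zx) \<bullet> (J z *v w)"
    by (rule H_J_symmetric)
  ultimately have taylor: "(p - H z *v w) \<bullet> Gz + (dF - J z *v w) \<bullet> - (H z *v zx) =
      p \<bullet> Gz - (H z *v zt) \<bullet> w - (H z *v zx) \<bullet> dF"
    by (simp add: expand z[symmetric] inner_commute)
  have hyp: "\<epsilon> * ((H y *v wt + (H y - H z) *v zt) \<bullet> wt) =
      \<epsilon> * (wt \<bullet> (H y *v wt)) + ((H y - H z) *v zt) \<bullet> (\<epsilon> *\<^sub>R wt)"
    "\<epsilon> * ((H y *v wx + (H y - H z) *v zx) \<bullet> (A *v wx)) =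
      \<epsilon> * ((H y *v wx) \<bullet> (A *v wx)) - ((H y - H z) *v zx) \<bullet> - (\<epsilon> *\<^sub>R (A *v wx))"
    by (simp_all add: inner_add_left inner_commute algebra_simps)
  show ?thesis
    unfolding eq hyp wt w_def[symmetric] p_def[symmetric] dF_def[symmetric]
    using p taylor by (simp add: algebra_simps)
qed

text \<open>After discarding the dissipation, every remaining term is a product of two amplitudes
  among \<open>|y - z|\<close>, \<open>\<epsilon> |wt|\<close>, \<open>\<epsilon> |wx|\<close>,
  \<open>\<epsilon> |R|\<close>, or \<open>|y - z|^2\<close> times a bounded quantity. Since each
  factor \<epsilon> is used up in this way, \<open>C\<close> can be fixed before \<epsilon>.\<close>

lemma production_le:
  assumes "0 \<le> B" "0 \<le> L"
  obtains C where "0 < C"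
    "\<And>\<epsilon> y z wt wx wtt wxt wxx zt zx Gz d R.
      zt + J z *v zx = Gz \<Longrightarrow>
      (zt + wt) + J y *v (zx + wx) = (Gz + d) + \<epsilon> *\<^sub>R (A *v wxx - wtt + R) \<Longrightarrow>
      norm zt \<le> B \<Longrightarrow> norm zx \<le> B \<Longrightarrow> norm Gz \<le> B \<Longrightarrow> norm (H z *v zx) \<le> B \<Longrightarrow>
      norm d \<le> L * norm (y - z) \<Longrightarrow> 0 < \<epsilon> \<Longrightarrow>
      energy' \<epsilon> y z wt wx (zt + wt) zt wtt wxt + flux' \<epsilon> y z wt wx (zx + wx) zx wxt wxx
        \<le> C * (energy_norm \<epsilon> (y - z) wx wt + \<epsilon>\<^sup>2 * (norm R)\<^sup>2)"
proof -
  \<comment> \<open>The coefficients of the nine error terms of \<open>production_eq\<close>, in the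
    order of the estimates 1 to 9 below.\<close>
  define C where "C = \<alpha> * L + \<alpha> * 1 + M * B + M * B + M * B * 1 + M * B * norm A
    + L * \<alpha> + 1 * \<alpha> + M * B * \<alpha>"
  show ?thesis
  proof (rule that)
    show "0 < C"
      using assms pos unfolding C_def by (intro add_pos_nonneg add_nonneg_pos add_nonneg_nonneg) auto
    fix \<epsilon> :: real and y z wt wx wtt wxt wxx zt zx Gz d R :: "real ^ 'n"
    assume eqs: "zt + J z *v zx = Gz"
      "(zt + wt) + J y *v (zx + wx) = (Gz + d) + \<epsilon> *\<^sub>R (A *v wxx - wtt + R)"
      and B: "norm zt \<le> B" "norm zx \<le> B" "norm Gz \<le> B" "norm (H z *v zx) \<le> B"
      and d: "norm d \<le> L * norm (y - z)" and \<epsilon>: "0 < \<epsilon>"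
    \<comment> \<open>With \<epsilon> absorbed into the amplitudes, \<open>S\<close> is the plain
      sum of their squares and dominates every product of two of them.\<close>
    define X Y Z Q where "X = norm (y - z)" and "Y = \<epsilon> * norm wt" and "Z = \<epsilon> * norm wx" and "Q = \<epsilon> * norm R"
    define S where "S = energy_norm \<epsilon> (y - z) wx wt + \<epsilon>\<^sup>2 * (norm R)\<^sup>2"
    have S: "S = X\<^sup>2 + Y\<^sup>2 + Z\<^sup>2 + Q\<^sup>2"
      by (simp add: S_def energy_norm_def X_def Y_def Z_def Q_def power_mult_distrib)
    have S_le: "X * X \<le> S" "X * Y \<le> S" "X * Z \<le> S" "X * Q \<le> S" "Q * Y \<le> S" "X\<^sup>2 * 1 \<le> S"
    proof -
      have "u * v \<le> (u\<^sup>2 + v\<^sup>2) / 2" for u v :: real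
        using sum_squares_bound[of u v] by simp
      note prods = this[of X X] this[of X Y] this[of X Z] this[of X Q] this[of Q Y]
      note nonneg = zero_le_power2[of X] zero_le_power2[of Y] zero_le_power2[of Z] zero_le_power2[of Q]
      show "X * X \<le> S" "X * Y \<le> S" "X * Z \<le> S" "X * Q \<le> S" "Q * Y \<le> S" "X\<^sup>2 * 1 \<le> S"
        using prods nonneg S by argo+
    qed
    have MB: "norm ((H y - H z) *v zt) \<le> M * B * X" "norm ((H y - H z) *v zx) \<le> M * B * X"
      "norm ((J y - J z) *v zx) \<le> M * B * X"
    proof -
      have "M * norm (y - z) * norm v \<le> M * B * X" if "norm v \<le> B" for v :: "real ^ 'n"
        using mult_left_mono[OF that, of "M * X"] pos by (simp add: X_def mult_ac)
      with B show "norm ((H y - H z) *v zt) \<le> M * B * X" "norm ((H y - H z) *v zx) \<le> M * B * X"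
        "norm ((J y - J z) *v zx) \<le> M * B * X"
        by (meson H_diff_le J_diff_le order_trans)+
    qed
    have A_wx: "norm (- (\<epsilon> *\<^sub>R (A *v wx))) \<le> norm A * Z"
      using mult_left_mono[OF norm_matrix_vector_mult_le[of A wx], of \<epsilon>] \<epsilon> by (simp add: Z_def mult_ac)
    have 1: "(N y - N z) \<bullet> d \<le> \<alpha> * L * S"
      by (rule inner_le_mult[of _ _ X _ _ X]) (use norm_gradient_diff_le d S_le assms pos in \<open>auto simp: X_def\<close>)
    have 2: "(N y - N z) \<bullet> (\<epsilon> *\<^sub>R R) \<le> \<alpha> * 1 * S"
      by (rule inner_le_mult[of _ _ X _ _ Q]) (use norm_gradient_diff_le S_le assms pos \<epsilon> in \<open>auto simp: X_def Q_def\<close>)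
    have 3: "(N y - N z - H z *v (y - z)) \<bullet> Gz \<le> M * B * S"
      by (rule inner_le_mult[of _ _ "X\<^sup>2" _ _ 1]) (use N_taylor B S_le assms pos in \<open>auto simp: X_def\<close>)
    have 4: "(F y - F z - J z *v (y - z)) \<bullet> - (H z *v zx) \<le> M * B * S"
      by (rule inner_le_mult[of _ _ "X\<^sup>2" _ _ 1]) (use F_taylor B S_le assms pos in \<open>auto simp: X_def\<close>)
    have 5: "((H y - H z) *v zt) \<bullet> (\<epsilon> *\<^sub>R wt) \<le> M * B * 1 * S"
      by (rule inner_le_mult[of _ _ X _ _ Y]) (use MB S_le assms pos \<epsilon> in \<open>auto simp: Y_def\<close>)
    have 6: "((H y - H z) *v zx) \<bullet> - (\<epsilon> *\<^sub>R (A *v wx)) \<le> M * B * norm A * S"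
      by (rule inner_le_mult[of _ _ X _ _ Z]) (use MB A_wx S_le assms pos in auto)
    have 7: "d \<bullet> (\<alpha> *\<^sub>R \<epsilon> *\<^sub>R wt) \<le> L * \<alpha> * S"
      by (rule inner_le_mult[of _ _ X _ _ Y]) (use d S_le assms pos \<epsilon> in \<open>auto simp: X_def Y_def\<close>)
    have 8: "(\<epsilon> *\<^sub>R R) \<bullet> (\<alpha> *\<^sub>R \<epsilon> *\<^sub>R wt) \<le> 1 * \<alpha> * S"
      by (rule inner_le_mult[of _ _ Q _ _ Y]) (use S_le assms pos \<epsilon> in \<open>auto simp: Q_def Y_def\<close>)
    have 9: "((J y - J z) *v zx) \<bullet> - (\<alpha> *\<^sub>R \<epsilon> *\<^sub>R wt) \<le> M * B * \<alpha> * S"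
      by (rule inner_le_mult[of _ _ X _ _ Y]) (use MB S_le assms pos \<epsilon> in \<open>auto simp: Y_def\<close>)
    have "- \<epsilon> * (\<alpha> * (wt \<bullet> wt) - wt \<bullet> (H y *v wt) + (H y *v wx) \<bullet> (A *v wx)
        + \<alpha> * (wt \<bullet> (J y *v wx))) \<le> 0"
      using dissipation_nonneg[of wt y wx] \<epsilon> by simp
    then show "energy' \<epsilon> y z wt wx (zt + wt) zt wtt wxt + flux' \<epsilon> y z wt wx (zx + wx) zx wxt wxx
        \<le> C * (energy_norm \<epsilon> (y - z) wx wt + \<epsilon>\<^sup>2 * (norm R)\<^sup>2)"
      unfolding production_eq[OF eqs] S_def[symmetric] C_def distrib_right
      using 1 2 3 4 5 6 7 8 9 by linarith
  qed
qed

section \<open>The equations of both solutions and the decay of the flux\<close>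

lemma balance_law_quasilinear:
  assumes "balance_law_solution F G T z" "0 < T" "t \<in> {0..T}"
  shows "Dt T z x t + J (z x t) *v Dx z x t = G (z x t)"
proof -
  have "smooth_slab T z"
    using assms(1) by (simp add: balance_law_solution_def)
  from has_vector_derivative_along(3)[OF smooth_slab_derivatives(1)[OF this assms(2,3)]]
  have "Dx (\<lambda>x t. F (z x t)) x t = J (z x t) *v Dx z x t"
    unfolding Dx_def by (rule vector_derivative_at)
  moreover have "Dt T z x t + Dx (\<lambda>x t. F (z x t)) x t = G (z x t)"
    using assms(1,3) unfolding balance_law_solution_def by blast
  ultimately show ?thesis
    by simp
qed

text \<open>Differentiating the equation for \<open>v\<close> in \<open>x\<close> replaces
  \<open>W\<close> by the source, which removes the free constant of integration at each time; what
  is left of \<open>v\<close> is expressed through \<open>Dx v = - Dt T u\<close>.\<close>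

lemma relaxation_second_order:
  assumes sol: "relaxation_solution F G A \<epsilon> T u v" and T: "0 < T" and t: "t \<in> {0..T}" and \<epsilon>: "0 < \<epsilon>"
  shows "Dt T u x t + J (u x t) *v Dx u x t =
    G (u x t) + \<epsilon> *\<^sub>R (A *v Dx (Dx u) x t - Dt T (Dt T u) x t)"
proof -
  have u: "smooth_slab T u" and v: "smooth_slab T v"
    using sol by (auto simp: relaxation_solution_def)
  obtain W where W: "\<And>x t. t \<in> {0..T} \<Longrightarrow> ((\<lambda>z. W z t) has_vector_derivative G (u x t)) (at x)"
    and ut0: "\<And>x t. t \<in> {0..T} \<Longrightarrow> Dt T u x t + Dx v x t = 0"
    and vt0: "\<And>x t. t \<in> {0..T} \<Longrightarrow>
      Dt T v x t + A *v Dx u x t = - (1 / \<epsilon>) *\<^sub>R (v x t - F (u x t) + W x t)"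
    using sol unfolding relaxation_solution_def by blast
  have ut: "Dx v x t = - Dt T u x t" if "t \<in> {0..T}" for x t
    using ut0[OF that, of x] by (simp add: add_eq_0_iff)
  have vt: "Dt T v x t = - (1 / \<epsilon>) *\<^sub>R (v x t - F (u x t) + W x t) - A *v Dx u x t"
    if "t \<in> {0..T}" for x t
    unfolding eq_diff_eq by (rule vt0[OF that])
  let ?r = "- (1 / \<epsilon>) *\<^sub>R (Dx v x t - J (u x t) *v Dx u x t + G (u x t)) - A *v Dx (Dx u) x t"
  have "((\<lambda>y. - (1 / \<epsilon>) *\<^sub>R (v y t - F (u y t) + W y t) - A *v Dx u y t) has_vector_derivative ?r) (at x)"
    by (intro has_vector_derivative_diff has_vector_derivative_add has_vector_derivative_along
        bounded_linear.has_vector_derivative[OF bounded_linear_scaleR_right]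
        smooth_slab_derivatives(1)[OF _ T t] u v smooth_slab_Dx[OF u T] W t)
  then have "((\<lambda>y. Dt T v y t) has_vector_derivative ?r) (at x)"
    unfolding vt[OF t] .
  from vector_derivative_unique_at[OF this smooth_slab_derivatives(1)[OF smooth_slab_Dt[OF v T] T t]]
  have "Dx (Dt T v) x t = ?r" ..
  \<comment> \<open>The relation \<open>Dx v = - Dt T u\<close> holds on the whole slab, so it may
    be differentiated in time within \<open>{0..T}\<close>, end points included.\<close>
  moreover have "Dx (Dt T v) x t = - Dt T (Dt T u) x t"
  proof -
    have "((\<lambda>s. - Dt T u x s) has_vector_derivative - Dt T (Dt T u) x t) (at t within {0..T})"
      by (intro has_vector_derivative_minus smooth_slab_derivatives(2)[OF _ T t] smooth_slab_Dt u T)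
    then have "((\<lambda>s. Dx v x s) has_vector_derivative - Dt T (Dt T u) x t) (at t within {0..T})"
      by (rule has_vector_derivative_transform[OF t ut, rotated])
    then have "Dt T (Dx v) x t = - Dt T (Dt T u) x t"
      unfolding Dt_def[of T "Dx v"] by (rule vector_derivative_within_closed_interval[OF T t])
    then show ?thesis
      by (simp add: smooth_slab_Dx_Dt[OF v T t])
  qed
  moreover define m where "m = Dt T u x t + J (u x t) *v Dx u x t - G (u x t)"
  then have "Dx v x t - J (u x t) *v Dx u x t + G (u x t) = - m"
    by (simp add: ut[OF t])
  ultimately have "- (1 / \<epsilon>) *\<^sub>R - m - A *v Dx (Dx u) x t = - Dt T (Dt T u) x t"
    by simp
  then have "(1 / \<epsilon>) *\<^sub>R m = A *v Dx (Dx u) x t - Dt T (Dt T u) x t"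
    by (simp add: algebra_simps)
  from arg_cong[OF this, of "scaleR \<epsilon>"]
  have "m = \<epsilon> *\<^sub>R (A *v Dx (Dx u) x t - Dt T (Dt T u) x t)"
    using \<epsilon> by simp
  then show ?thesis
    by (simp add: m_def algebra_simps)
qed

text \<open>The flux is a continuous function of its four arguments that vanishes at the origin, so
  it is small wherever all four are; each of them receives a quarter of the radius
  \<open>d\<close>.\<close>

lemma flux_uniform_decay:
  assumes \<delta>: "0 < \<delta>" and g: "(g \<longlongrightarrow> 0) at_infinity"
    and y: "\<And>x t. t \<in> I \<Longrightarrow> norm (y x t) \<le> g x" and z: "\<And>x t. t \<in> I \<Longrightarrow> norm (z x t) \<le> g x"
    and wt: "\<And>x t. t \<in> I \<Longrightarrow> norm (wt x t) \<le> g x" and wx: "\<And>x t. t \<in> I \<Longrightarrow> norm (wx x t) \<le> g x"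
  shows "\<forall>\<^sub>F x in at_infinity. \<forall>t\<in>I. \<bar>flux \<epsilon> (y x t) (z x t) (wt x t) (wx x t)\<bar> \<le> \<delta>"
proof -
  let ?\<Phi> = "\<lambda>p. flux \<epsilon> (fst p) (fst (snd p)) (fst (snd (snd p))) (snd (snd (snd p)))"
  have "continuous_on UNIV ?\<Phi>"
    by (intro continuous_on_flux continuous_intros)
  moreover have "?\<Phi> 0 = 0"
    by (simp add: flux_def)
  ultimately obtain d where d: "0 < d" "\<And>p. norm p < d \<Longrightarrow> \<bar>?\<Phi> p\<bar> < \<delta>"
    using \<delta> unfolding continuous_on_iff by (metis UNIV_I diff_zero dist_norm real_norm_def)
  have "\<forall>\<^sub>F x in at_infinity. g x < d / 4"
    using g by (rule order_tendstoD) (simp add: d)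
  then show ?thesis
  proof eventually_elim
    case (elim x)
    show ?case
    proof
      fix t assume t: "t \<in> I"
      have "norm (y x t, z x t, wt x t, wx x t) \<le>
          norm (y x t) + (norm (z x t) + (norm (wt x t) + norm (wx x t)))"
        by (intro order_trans[OF norm_Pair_le] add_left_mono order_refl)
      also have "\<dots> < d"
        using y[OF t, of x] z[OF t, of x] wt[OF t, of x] wx[OF t, of x] elim by simp
      finally show "\<bar>flux \<epsilon> (y x t) (z x t) (wt x t) (wx x t)\<bar> \<le> \<delta>"
        using d(2)[of "(y x t, z x t, wt x t, wx x t)"] by simp
    qed
  qed
qed

subsection \<open>Stability\<close>

text \<open>The mixed derivative is written as \<open>Dt T (Dx _)\<close> in both identities, so
  that both contain the same vector \<open>wxt\<close> of \<open>production_eq\<close>.\<close>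

lemma energy_identities:
  fixes u z :: "real \<Rightarrow> real \<Rightarrow> real ^ 'n"
  assumes T: "0 < T" and u: "smooth_slab T u" and z: "smooth_slab T z" and t: "t \<in> {0..T}"
  shows "((\<lambda>s. energy \<epsilon> (u x s) (z x s) (Dt T u x s - Dt T z x s) (Dx u x s - Dx z x s))
      has_vector_derivative energy' \<epsilon> (u x t) (z x t) (Dt T u x t - Dt T z x t) (Dx u x t - Dx z x t)
        (Dt T u x t) (Dt T z x t) (Dt T (Dt T u) x t - Dt T (Dt T z) x t)
        (Dt T (Dx u) x t - Dt T (Dx z) x t)) (at t within {0..T})"
    and "((\<lambda>y. flux \<epsilon> (u y t) (z y t) (Dt T u y t - Dt T z y t) (Dx u y t - Dx z y t))
      has_vector_derivative flux' \<epsilon> (u x t) (z x t) (Dt T u x t - Dt T z x t) (Dx u x t - Dx z x t)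
        (Dx u x t) (Dx z x t) (Dt T (Dx u) x t - Dt T (Dx z) x t)
        (Dx (Dx u) x t - Dx (Dx z) x t)) (at x)"
proof -
  note smooths = u z smooth_slab_Dx[OF u T] smooth_slab_Dx[OF z T] smooth_slab_Dt[OF u T] smooth_slab_Dt[OF z T]
  show "((\<lambda>s. energy \<epsilon> (u x s) (z x s) (Dt T u x s - Dt T z x s) (Dx u x s - Dx z x s))
      has_vector_derivative energy' \<epsilon> (u x t) (z x t) (Dt T u x t - Dt T z x t) (Dx u x t - Dx z x t)
        (Dt T u x t) (Dt T z x t) (Dt T (Dt T u) x t - Dt T (Dt T z) x t)
        (Dt T (Dx u) x t - Dt T (Dx z) x t)) (at t within {0..T})"
    by (intro has_vector_derivative_energy has_vector_derivative_diff
        smooth_slab_derivatives(2)[OF _ T t] smooths)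
  show "((\<lambda>y. flux \<epsilon> (u y t) (z y t) (Dt T u y t - Dt T z y t) (Dx u y t - Dx z y t))
      has_vector_derivative flux' \<epsilon> (u x t) (z x t) (Dt T u x t - Dt T z x t) (Dx u x t - Dx z x t)
        (Dx u x t) (Dx z x t) (Dt T (Dx u) x t - Dt T (Dx z) x t)
        (Dx (Dx u) x t - Dx (Dx z) x t)) (at x)"
    unfolding smooth_slab_Dx_Dt[OF u T t, symmetric] smooth_slab_Dx_Dt[OF z T t, symmetric]
    by (intro has_vector_derivative_flux has_vector_derivative_diff
        smooth_slab_derivatives(1)[OF _ T t] smooths)
qed

text \<open>Mind the order of arguments: \<open>energy_norm\<close> follows \<open>Psi\<close> and
  takes \<open>wx\<close> before \<open>wt\<close>, whereas \<open>energy\<close> takes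
  \<open>wt\<close> first.\<close>

lemma Psi_eq_energy_norm:
  fixes u z :: "real \<Rightarrow> real \<Rightarrow> real ^ 'n"
  assumes T: "0 < T" and u: "smooth_slab T u" and z: "smooth_slab T z" and t: "t \<in> {0..T}"
  shows "Psi T z \<epsilon> u t = (LINT x|lborel.
    energy_norm \<epsilon> (u x t - z x t) (Dx u x t - Dx z x t) (Dt T u x t - Dt T z x t))"
proof -
  have "Dx (\<lambda>x t. z x t - u x t) x t = Dx z x t - Dx u x t" for x
    unfolding Dx_def[of "\<lambda>x t. z x t - u x t"]
    by (intro vector_derivative_at has_vector_derivative_diff smooth_slab_derivatives(1)[OF _ T t] u z)
  moreover have "Dt T (\<lambda>x t. z x t - u x t) x t = Dt T z x t - Dt T u x t" for x
    unfolding Dt_def[of T "\<lambda>x t. z x t - u x t"]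
    by (intro vector_derivative_within_closed_interval[OF T t] has_vector_derivative_diff
        smooth_slab_derivatives(2)[OF _ T t] u z)
  ultimately show ?thesis
    by (simp add: Psi_def energy_norm_def norm_minus_commute)
qed

text \<open>The values of \<open>z\<close> stay in a ball, which serves as the compact set of the
  source condition. The other argument of \<open>G\<close> is unrestricted there, as is essential
  without uniform bounds on \<open>u\<close>.\<close>

lemma background_bounds:
  assumes T: "0 < T" and G0: "G 0 = 0"
    and G: "\<And>K. compact K \<Longrightarrow> \<exists>L>0. \<forall>u. \<forall>w\<in>K. norm (G u - G w) \<le> L * norm (u - w)"
    and z: "smooth_slab T z" "decays_fast T z"
  obtains B L where "0 \<le> B" "0 \<le> L"
    "\<And>x t. t \<in> {0..T} \<Longrightarrow> norm (Dt T z x t) \<le> B" "\<And>x t. t \<in> {0..T} \<Longrightarrow> norm (Dx z x t) \<le> B"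
    "\<And>x t. t \<in> {0..T} \<Longrightarrow> norm (G (z x t)) \<le> B"
    "\<And>x t. t \<in> {0..T} \<Longrightarrow> norm (H (z x t) *v Dx z x t) \<le> B"
    "\<And>x t u. t \<in> {0..T} \<Longrightarrow> norm (G u - G (z x t)) \<le> L * norm (u - z x t)"
proof -
  obtain g where g: "(g \<longlongrightarrow> 0) at_infinity"
    and zg: "\<And>x t. t \<in> {0..T} \<Longrightarrow> norm (z x t) \<le> g x" "\<And>x t. t \<in> {0..T} \<Longrightarrow> norm (Dx z x t) \<le> g x"
      "\<And>x t. t \<in> {0..T} \<Longrightarrow> norm (Dt T z x t) \<le> g x"
    using decays_fastE[OF z(2)] by metis
  obtain B0 where B0: "\<And>x t. t \<in> {0..T} \<Longrightarrow> norm (z x t) \<le> B0"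
    using bounded_of_decay[OF smooth_slab_continuous_on[OF z(1)] g zg(1)] by blast
  obtain B1 where B1: "\<And>x t. t \<in> {0..T} \<Longrightarrow> norm (Dx z x t) \<le> B1"
    using bounded_of_decay[OF smooth_slab_continuous_on[OF smooth_slab_Dx[OF z(1) T]] g zg(2)] by blast
  obtain B2 where B2: "\<And>x t. t \<in> {0..T} \<Longrightarrow> norm (Dt T z x t) \<le> B2"
    using bounded_of_decay[OF smooth_slab_continuous_on[OF smooth_slab_Dt[OF z(1) T]] g zg(3)] by blast
  have "bounded (H ` cball 0 B0)"
    by (intro compact_imp_bounded compact_continuous_image continuous_on_H) simp
  then obtain BH where BH: "0 < BH" "\<And>v. norm v \<le> B0 \<Longrightarrow> norm (H v) \<le> BH"
    unfolding bounded_pos by auto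
  obtain L where L: "0 < L" "\<And>u w. norm w \<le> B0 \<Longrightarrow> norm (G u - G w) \<le> L * norm (u - w)"
    using G[of "cball 0 B0"] by auto
  \<comment> \<open>The compact set \<open>{0}\<close> and \<open>G 0 = 0\<close> give linear growth
    of \<open>G\<close>, hence a bound on \<open>G\<close> along \<open>z\<close>.\<close>
  obtain L0 where L0: "0 < L0" "\<And>u. norm (G u) \<le> L0 * norm u"
    using G[of "{0}"] G0 by auto
  have nn: "0 \<le> B0" "0 \<le> B1" "0 \<le> B2"
    using B0[of 0] B1[of 0] B2[of 0] T by (auto intro: order_trans[OF norm_ge_zero])
  define B where "B = B2 + B1 + L0 * B0 + BH * B1"
  have nn': "0 \<le> L0 * B0" "0 \<le> BH * B1"
    using nn L0 BH by simp_all
  show ?thesis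
  proof (rule that[of B L])
    show "0 \<le> B" "0 \<le> L"
      using nn nn' L by (simp_all add: B_def)
    fix x t assume t: "t \<in> {0..T}"
    show "norm (Dt T z x t) \<le> B" "norm (Dx z x t) \<le> B"
      using B1[OF t, of x] B2[OF t, of x] nn nn' unfolding B_def by linarith+
    have "norm (G (z x t)) \<le> L0 * B0"
      using L0(2)[of "z x t"] mult_left_mono[OF B0[OF t, of x], of L0] L0(1) by linarith
    then show "norm (G (z x t)) \<le> B"
      using nn nn' unfolding B_def by linarith
    have "norm (H (z x t) *v Dx z x t) \<le> BH * B1"
      using norm_matrix_vector_mult_le BH(1) mult_mono[OF BH(2)[OF B0[OF t, of x]] B1[OF t, of x]]
      by (meson less_imp_le norm_ge_zero order_trans)
    then show "norm (H (z x t) *v Dx z x t) \<le> B"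
      using nn nn' unfolding B_def by linarith
    show "norm (G u - G (z x t)) \<le> L * norm (u - z x t)" for u
      by (rule L(2)[OF B0[OF t]])
  qed
qed

text \<open>All ingredients of \<open>C\<close> come from the system and from \<open>z\<close>. The
  decay rate \<open>gu\<close> of \<open>u\<close> serves only for integrability and for the
  vanishing of the flux at infinity, so \<open>C\<close> is independent of \<epsilon> and
  \<open>u\<close>.\<close>

lemma stability_estimate:
  assumes T: "0 < T" and G0: "G 0 = 0"
    and G: "\<And>K. compact K \<Longrightarrow> \<exists>L>0. \<forall>u. \<forall>w\<in>K. norm (G u - G w) \<le> L * norm (u - w)"
    and z: "balance_law_solution F G T z" "decays_fast T z"
  obtains C where "0 < C"
    "\<And>\<epsilon> u v t. 0 < \<epsilon> \<Longrightarrow> relaxation_solution F G A \<epsilon> T u v \<Longrightarrow> decays_fast T u \<Longrightarrow> t \<in> {0..T} \<Longrightarrow>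
      Psi T z \<epsilon> u t \<le> C * (Psi T z \<epsilon> u 0 + \<epsilon>\<^sup>2)"
proof -
  have zs: "smooth_slab T z"
    using z(1) by (simp add: balance_law_solution_def)
  obtain B L where BL: "0 \<le> B" "0 \<le> L"
    and B: "\<And>x t. t \<in> {0..T} \<Longrightarrow> norm (Dt T z x t) \<le> B" "\<And>x t. t \<in> {0..T} \<Longrightarrow> norm (Dx z x t) \<le> B"
      "\<And>x t. t \<in> {0..T} \<Longrightarrow> norm (G (z x t)) \<le> B"
      "\<And>x t. t \<in> {0..T} \<Longrightarrow> norm (H (z x t) *v Dx z x t) \<le> B"
    and L: "\<And>x t u. t \<in> {0..T} \<Longrightarrow> norm (G u - G (z x t)) \<le> L * norm (u - z x t)"
    using background_bounds[OF T G0 G zs z(2)] by blast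
  obtain c where c: "0 < c"
    and energy_ge: "\<And>\<epsilon> y z wt wx. c * energy_norm \<epsilon> (y - z) wx wt \<le> energy \<epsilon> y z wt wx"
    using energy_ge by blast
  obtain C0 where C0: "0 < C0"
    and energy_le: "\<And>\<epsilon> y z wt wx. energy \<epsilon> y z wt wx \<le> C0 * energy_norm \<epsilon> (y - z) wx wt"
    using energy_le by blast
  obtain C1 where C1: "0 < C1"
    and production: "\<And>\<epsilon> y z wt wx wtt wxt wxx zt zx Gz d R.
      zt + J z *v zx = Gz \<Longrightarrow>
      (zt + wt) + J y *v (zx + wx) = (Gz + d) + \<epsilon> *\<^sub>R (A *v wxx - wtt + R) \<Longrightarrow>
      norm zt \<le> B \<Longrightarrow> norm zx \<le> B \<Longrightarrow> norm Gz \<le> B \<Longrightarrow> norm (H z *v zx) \<le> B \<Longrightarrow>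
      norm d \<le> L * norm (y - z) \<Longrightarrow> 0 < \<epsilon> \<Longrightarrow>
      energy' \<epsilon> y z wt wx (zt + wt) zt wtt wxt + flux' \<epsilon> y z wt wx (zx + wx) zx wxt wxx
        \<le> C1 * (energy_norm \<epsilon> (y - z) wx wt + \<epsilon>\<^sup>2 * (norm R)\<^sup>2)"
    using production_le[OF BL] by blast
  obtain gz where gz: "(gz \<longlongrightarrow> 0) at_infinity" "integrable lborel (\<lambda>x. (gz x)\<^sup>2)"
    and zg: "\<And>x t. t \<in> {0..T} \<Longrightarrow> norm (z x t) \<le> gz x"
      "\<And>x t. t \<in> {0..T} \<Longrightarrow> norm (Dx z x t) \<le> gz x"
      "\<And>x t. t \<in> {0..T} \<Longrightarrow> norm (Dt T z x t) \<le> gz x"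
      "\<And>x t. t \<in> {0..T} \<Longrightarrow> norm (Dx (Dx z) x t) \<le> gz x"
      "\<And>x t. t \<in> {0..T} \<Longrightarrow> norm (Dt T (Dt T z) x t) \<le> gz x"
    using decays_fastE[OF z(2)] by metis
  \<comment> \<open>\<open>K\<close> converts the production bound \<open>C1 * n\<close> into
    \<open>K * e\<close> because \<open>c * n \<le> e\<close>; \<open>D\<close> stems from
    \<open>norm R \<le> (norm A + 1) * gz\<close> for the residual \<open>R\<close>. In
    \<open>C\<close>, the factor \<open>C0\<close> bounds the initial energy,
    \<open>T * (D * I)\<close> the accumulated residual, and division by \<open>c\<close> returns
    from energy to \<open>Psi\<close>.\<close>
  define K where "K = C1 / c"
  define D where "D = C1 * (norm A + 1)\<^sup>2"
  define I where "I = (LINT x|lborel. (gz x)\<^sup>2)"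
  define C where "C = exp (K * T) / c * (C0 + T * (D * I))"
  have K: "0 \<le> K" and D: "0 \<le> D" and I: "0 \<le> I"
    using c C1 by (simp_all add: K_def D_def I_def)
  show ?thesis
  proof (rule that)
    show "0 < C"
      using c C0 T D I unfolding C_def by (intro mult_pos_pos divide_pos_pos add_pos_nonneg) simp_all
    fix \<epsilon> t0 :: real and u v :: "real \<Rightarrow> real \<Rightarrow> real ^ 'n"
    assume \<epsilon>: "0 < \<epsilon>" and sol: "relaxation_solution F G A \<epsilon> T u v" and u: "decays_fast T u"
      and t0: "t0 \<in> {0..T}"
    have us: "smooth_slab T u"
      using sol by (simp add: relaxation_solution_def)
    obtain gu where gu: "(gu \<longlongrightarrow> 0) at_infinity" "integrable lborel (\<lambda>x. (gu x)\<^sup>2)"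
      and ug: "\<And>x t. t \<in> {0..T} \<Longrightarrow> norm (u x t) \<le> gu x"
        "\<And>x t. t \<in> {0..T} \<Longrightarrow> norm (Dx u x t) \<le> gu x"
        "\<And>x t. t \<in> {0..T} \<Longrightarrow> norm (Dt T u x t) \<le> gu x"
      using decays_fastE[OF u] by metis
    define wt where "wt = (\<lambda>x t. Dt T u x t - Dt T z x t)"
    define wx where "wx = (\<lambda>x t. Dx u x t - Dx z x t)"
    define e where "e = (\<lambda>x t. energy \<epsilon> (u x t) (z x t) (wt x t) (wx x t))"
    define e' where "e' = (\<lambda>x t. energy' \<epsilon> (u x t) (z x t) (wt x t) (wx x t)
        (Dt T u x t) (Dt T z x t) (Dt T (Dt T u) x t - Dt T (Dt T z) x t)
        (Dt T (Dx u) x t - Dt T (Dx z) x t))"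
    define f where "f = (\<lambda>x t. flux \<epsilon> (u x t) (z x t) (wt x t) (wx x t))"
    define f' where "f' = (\<lambda>x t. flux' \<epsilon> (u x t) (z x t) (wt x t) (wx x t)
        (Dx u x t) (Dx z x t) (Dt T (Dx u) x t - Dt T (Dx z) x t)
        (Dx (Dx u) x t - Dx (Dx z) x t))"
    define n where "n = (\<lambda>x t. energy_norm \<epsilon> (u x t - z x t) (wx x t) (wt x t))"
    have sub: "t \<in> {0..T}" if "t \<in> {0..t0}" for t
      using that t0 by simp
    have zero: "0 \<in> {0..T}"
      using T by simp

    have e_n: "c * n x t \<le> e x t" "e x t \<le> C0 * n x t" for x t
      unfolding e_def n_def by (rule energy_ge energy_le)+
    have n_nonneg: "0 \<le> n x t" for x t
      by (simp add: n_def energy_norm_def)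
    have e_nonneg: "0 \<le> e x t" for x t
      using e_n(1)[of x t] n_nonneg[of x t] c by (meson less_imp_le mult_nonneg_nonneg order_trans)

    have balance: "e' x t + f' x t \<le> K * e x t + \<epsilon>\<^sup>2 * (D * (gz x)\<^sup>2)" if t: "t \<in> {0..T}" for x t
    proof -
      define R where "R = A *v Dx (Dx z) x t - Dt T (Dt T z) x t"
      have "norm R \<le> norm A * gz x + gz x"
        unfolding R_def
        using norm_triangle_ineq4[of "A *v Dx (Dx z) x t" "Dt T (Dt T z) x t"] zg(5)[OF t, of x]
          norm_matrix_vector_mult_le[of A "Dx (Dx z) x t"]
          mult_left_mono[OF zg(4)[OF t, of x] norm_ge_zero[of A]]
        by linarith
      then have "(norm R)\<^sup>2 \<le> ((norm A + 1) * gz x)\<^sup>2"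
        by (intro power_mono) (simp_all add: distrib_right)
      then have R: "C1 * (\<epsilon>\<^sup>2 * (norm R)\<^sup>2) \<le> \<epsilon>\<^sup>2 * (D * (gz x)\<^sup>2)"
        using mult_left_mono[of "(norm R)\<^sup>2" "((norm A + 1) * gz x)\<^sup>2" "C1 * \<epsilon>\<^sup>2"] C1
        by (simp add: D_def power_mult_distrib mult_ac)
      have "e' x t + f' x t \<le> C1 * (n x t + \<epsilon>\<^sup>2 * (norm R)\<^sup>2)"
      proof -
        have eq: "Dt T z x t + wt x t = Dt T u x t" "Dx z x t + wx x t = Dx u x t"
          by (simp_all add: wt_def wx_def)
        have "energy' \<epsilon> (u x t) (z x t) (wt x t) (wx x t) (Dt T z x t + wt x t) (Dt T z x t)
            (Dt T (Dt T u) x t - Dt T (Dt T z) x t) (Dt T (Dx u) x t - Dt T (Dx z) x t)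
          + flux' \<epsilon> (u x t) (z x t) (wt x t) (wx x t) (Dx z x t + wx x t) (Dx z x t)
            (Dt T (Dx u) x t - Dt T (Dx z) x t) (Dx (Dx u) x t - Dx (Dx z) x t)
          \<le> C1 * (energy_norm \<epsilon> (u x t - z x t) (wx x t) (wt x t) + \<epsilon>\<^sup>2 * (norm R)\<^sup>2)"
        proof (rule production[OF balance_law_quasilinear[OF z(1) T t] _ B[OF t] L[OF t] \<epsilon>])
          \<comment> \<open>Adding and subtracting \<open>R\<close> splits the second derivatives of
            \<open>u\<close> into those of the difference and the residual of
            \<open>z\<close>.\<close>
          show "Dt T z x t + wt x t + J (u x t) *v (Dx z x t + wx x t) =
              G (z x t) + (G (u x t) - G (z x t)) +
              \<epsilon> *\<^sub>R (A *v (Dx (Dx u) x t - Dx (Dx z) x t) - (Dt T (Dt T u) x t - Dt T (Dt T z) x t) + R)"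
            unfolding eq relaxation_second_order[OF sol T t \<epsilon>]
            by (simp add: R_def matrix_vector_mult_diff_distrib)
        qed
        then show ?thesis
          unfolding eq e'_def f'_def n_def .
      qed
      moreover have "C1 * n x t \<le> K * e x t"
        using mult_left_mono[OF e_n(1)[of x t], of K] K c by (simp add: K_def)
      ultimately show ?thesis
        using R by (simp add: distrib_left)
    qed

    have cont_row: "continuous_on UNIV (\<lambda>x. w x t)" if "smooth_slab T w" "t \<in> {0..T}" for w :: "real \<Rightarrow> real \<Rightarrow> real ^ 'n" and t
      using continuous_on_compose2[OF smooth_slab_continuous_on[OF that(1)], of UNIV "\<lambda>x. (x, t)"] that(2)
      by (force intro!: continuous_intros)
    note smooths = us zs smooth_slab_Dx[OF us T] smooth_slab_Dx[OF zs T] smooth_slab_Dt[OF us T] smooth_slab_Dt[OF zs T]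
    \<comment> \<open>This majorant depends on \<epsilon> and \<open>u\<close>, but it is used only
      for integrability.\<close>
    have n_le: "n x t \<le> (1 + 2 * \<epsilon>\<^sup>2) * (2 * ((gu x)\<^sup>2 + (gz x)\<^sup>2))" if t: "t \<in> {0..T}" for x t
    proof -
      have sq: "(norm (a - b))\<^sup>2 \<le> 2 * ((gu x)\<^sup>2 + (gz x)\<^sup>2)" if "norm a \<le> gu x" "norm b \<le> gz x"
        for a b :: "real ^ 'n"
      proof -
        have "norm (a - b) \<le> gu x + gz x"
          using norm_triangle_ineq4[of a b] that by linarith
        then have "(norm (a - b))\<^sup>2 \<le> (gu x + gz x)\<^sup>2"
          by (intro power_mono) auto
        also have "\<dots> \<le> 2 * ((gu x)\<^sup>2 + (gz x)\<^sup>2)"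
          using sum_squares_bound[of "gu x" "gz x"] by (simp add: power2_sum)
        finally show ?thesis .
      qed
      show ?thesis
        using sq[OF ug(1) zg(1), OF t t] mult_left_mono[OF sq[OF ug(2) zg(2), OF t t], of "\<epsilon>\<^sup>2"]
          mult_left_mono[OF sq[OF ug(3) zg(3), OF t t], of "\<epsilon>\<^sup>2"]
        unfolding n_def energy_norm_def wt_def wx_def by (simp add: distrib_right)
    qed
    have n_int: "integrable lborel (\<lambda>x. n x t)" if t: "t \<in> {0..T}" for t
    proof (rule integrable_of_bound[OF _ _ n_nonneg n_le[OF t]])
      show "continuous_on UNIV (\<lambda>x. n x t)"
        unfolding n_def energy_norm_def wt_def wx_def
        by (intro continuous_intros cont_row smooths t)
    qed (use gu gz in simp)
    have e_int: "integrable lborel (\<lambda>x. e x t)" if t: "t \<in> {0..T}" for t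
    proof (rule integrable_of_bound[OF _ _ e_nonneg e_n(2)])
      show "continuous_on UNIV (\<lambda>x. e x t)"
        unfolding e_def wt_def wx_def
        by (intro continuous_on_energy continuous_on_diff cont_row smooths t)
    qed (use n_int[OF t] in simp)

    \<comment> \<open>The inequality is integrated up to \<open>t0\<close>, which may be 0. The
      weight does not depend on \<open>x\<close>, so the weighted flux remains an exact
      x-derivative.\<close>
    have "(LINT x|lborel. exp (- K * t0) * e x t0) \<le> (LINT x|lborel. exp (- K * 0) * e x 0)
        + t0 * (LINT x|lborel. \<epsilon>\<^sup>2 * (D * (gz x)\<^sup>2))"
    proof (rule integral_le_of_divergence_le[where f = "\<lambda>x t. exp (- K * t) * f x t"
          and at' = "\<lambda>x t. exp (- K * t) * e' x t + (- K * exp (- K * t)) * e x t"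
          and fx = "\<lambda>x t. exp (- K * t) * f' x t"])
      show "0 \<le> t0"
        using t0 by simp
      show "((\<lambda>t. exp (- K * t) * e x t) has_vector_derivative
          exp (- K * t) * e' x t + (- K * exp (- K * t)) * e x t) (at t within {0..t0})"
        if t: "t \<in> {0..t0}" for x t
      proof (rule has_vector_derivative_mult)
        show "((\<lambda>t. exp (- K * t)) has_vector_derivative - K * exp (- K * t)) (at t within {0..t0})"
          by (auto intro!: derivative_eq_intros simp: has_real_derivative_iff_has_vector_derivative[symmetric])
        show "((\<lambda>t. e x t) has_vector_derivative e' x t) (at t within {0..t0})"
          unfolding e_def e'_def wt_def wx_def
          by (rule has_vector_derivative_within_subset[OF energy_identities(1)[OF T us zs sub[OF t]]])
            (use t0 in auto)
      qed
      have cont: "continuous_on (UNIV \<times> {0..t0}) (\<lambda>p. w (fst p) (snd p))" if "smooth_slab T w"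
        for w :: "real \<Rightarrow> real \<Rightarrow> real ^ 'n"
        by (rule continuous_on_subset[OF smooth_slab_continuous_on[OF that]]) (use t0 in auto)
      show "continuous_on (UNIV \<times> {0..t0})
          (\<lambda>p. exp (- K * snd p) * e' (fst p) (snd p) + (- K * exp (- K * snd p)) * e (fst p) (snd p))"
        unfolding e_def e'_def wt_def wx_def
        by (intro continuous_on_add continuous_on_mult continuous_on_const continuous_on_exp
            continuous_on_snd continuous_on_id continuous_on_energy continuous_on_energy'
            continuous_on_diff cont smooths smooth_slab_Dt[OF _ T])
      show "((\<lambda>x. exp (- K * t) * f x t) has_vector_derivative exp (- K * t) * f' x t) (at x)"
        if t: "t \<in> {0..t0}" for x t
        unfolding f_def f'_def wt_def wx_def
        by (intro has_vector_derivative_mult_right energy_identities(2)[OF T us zs sub[OF t]])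
      show "exp (- K * t) * e' x t + (- K * exp (- K * t)) * e x t + exp (- K * t) * f' x t
          \<le> \<epsilon>\<^sup>2 * (D * (gz x)\<^sup>2)" if t: "t \<in> {0..t0}" for x t
      proof -
        have "exp (- K * t) * e' x t + (- K * exp (- K * t)) * e x t + exp (- K * t) * f' x t =
            exp (- K * t) * (e' x t + f' x t - K * e x t)"
          by (simp add: algebra_simps)
        also have "\<dots> \<le> exp (- K * t) * (\<epsilon>\<^sup>2 * (D * (gz x)\<^sup>2))"
          using balance[OF sub[OF t], of x] by (intro mult_left_mono) auto
        \<comment> \<open>The weight is at most 1, which leaves a source independent of
          \<open>t\<close>, as the integration lemma requires.\<close>
        also have "\<dots> \<le> 1 * (\<epsilon>\<^sup>2 * (D * (gz x)\<^sup>2))"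
          using K D t by (intro mult_right_mono) auto
        finally show ?thesis
          by simp
      qed
      show "integrable lborel (\<lambda>x. \<epsilon>\<^sup>2 * (D * (gz x)\<^sup>2))"
        using gz(2) by simp
      show "\<forall>\<^sub>F x in at_infinity. \<forall>t\<in>{0..t0}. \<bar>exp (- K * t) * f x t\<bar> \<le> \<delta>" if \<delta>: "0 < \<delta>" for \<delta>
      proof -
        have "((\<lambda>x. gu x + gz x) \<longlongrightarrow> 0) at_infinity"
          using tendsto_add[OF gu(1) gz(1)] by simp
        then have "\<forall>\<^sub>F x in at_infinity. \<forall>t\<in>{0..T}. \<bar>f x t\<bar> \<le> \<delta>"
          unfolding f_def
        proof (rule flux_uniform_decay[OF \<delta>])
          fix x t assume t: "t \<in> {0..T}"
          note bounds = ug[OF t, of x] zg[OF t, of x]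
          show "norm (u x t) \<le> gu x + gz x" "norm (z x t) \<le> gu x + gz x"
            using bounds norm_ge_zero[of "u x t"] norm_ge_zero[of "z x t"] by linarith+
          show "norm (wt x t) \<le> gu x + gz x" "norm (wx x t) \<le> gu x + gz x"
            using bounds norm_triangle_ineq4[of "Dt T u x t" "Dt T z x t"]
              norm_triangle_ineq4[of "Dx u x t" "Dx z x t"]
            unfolding wt_def wx_def by linarith+
        qed
        then show ?thesis
        proof eventually_elim
          case (elim x)
          show ?case
          proof
            fix t assume t: "t \<in> {0..t0}"
            have "\<bar>exp (- K * t) * f x t\<bar> \<le> 1 * \<bar>f x t\<bar>"
              using K t unfolding abs_mult by (intro mult_right_mono) auto
            then show "\<bar>exp (- K * t) * f x t\<bar> \<le> \<delta>"
              using elim sub[OF t] by force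
          qed
        qed
      qed
      show "integrable lborel (\<lambda>x. exp (- K * 0) * e x 0)" "integrable lborel (\<lambda>x. exp (- K * t0) * e x t0)"
        using e_int zero t0 by simp_all
    qed
    then have "exp (- K * t0) * (LINT x|lborel. e x t0) \<le> (LINT x|lborel. e x 0) + t0 * (\<epsilon>\<^sup>2 * (D * I))"
      by (simp add: I_def)
    then have "exp (K * t0) * (exp (- K * t0) * (LINT x|lborel. e x t0)) \<le>
        exp (K * t0) * ((LINT x|lborel. e x 0) + t0 * (\<epsilon>\<^sup>2 * (D * I)))"
      by (intro mult_left_mono) auto
    then have "(LINT x|lborel. e x t0) \<le> exp (K * t0) * ((LINT x|lborel. e x 0) + t0 * (\<epsilon>\<^sup>2 * (D * I)))"
      by (simp add: mult.assoc[symmetric] exp_add[symmetric])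
    also have "\<dots> \<le> exp (K * T) * (C0 * Psi T z \<epsilon> u 0 + T * (\<epsilon>\<^sup>2 * (D * I)))"
    proof (intro mult_mono add_mono)
      have "(LINT x|lborel. e x 0) \<le> (LINT x|lborel. C0 * n x 0)"
        by (intro integral_mono e_int integrable_mult_right n_int zero e_n)
      then show "(LINT x|lborel. e x 0) \<le> C0 * Psi T z \<epsilon> u 0"
        by (simp add: Psi_eq_energy_norm[OF T us zs zero] n_def wt_def wx_def)
    qed (use t0 K D I e_nonneg in \<open>auto intro!: mult_left_mono add_nonneg_nonneg integral_nonneg_AE\<close>)
    finally have e_le: "(LINT x|lborel. e x t0) \<le> exp (K * T) * (C0 * Psi T z \<epsilon> u 0 + T * (\<epsilon>\<^sup>2 * (D * I)))" .
    have "(LINT x|lborel. c * n x t0) \<le> (LINT x|lborel. e x t0)"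
      by (intro integral_mono e_int integrable_mult_right n_int t0 e_n)
    then have "c * Psi T z \<epsilon> u t0 \<le> (LINT x|lborel. e x t0)"
      by (simp add: Psi_eq_energy_norm[OF T us zs t0] n_def wt_def wx_def)
    also note e_le
    also have "exp (K * T) * (C0 * Psi T z \<epsilon> u 0 + T * (\<epsilon>\<^sup>2 * (D * I))) \<le>
        exp (K * T) * ((C0 + T * (D * I)) * (Psi T z \<epsilon> u 0 + \<epsilon>\<^sup>2))"
    proof (rule mult_left_mono)
      have "0 \<le> Psi T z \<epsilon> u 0"
        unfolding Psi_def by (intro integral_nonneg_AE) simp
      then have "0 \<le> T * (D * I) * Psi T z \<epsilon> u 0" "0 \<le> C0 * \<epsilon>\<^sup>2"
        using T D I C0 by simp_all
      then show "C0 * Psi T z \<epsilon> u 0 + T * (\<epsilon>\<^sup>2 * (D * I)) \<le> (C0 + T * (D * I)) * (Psi T z \<epsilon> u 0 + \<epsilon>\<^sup>2)"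
        by (simp add: algebra_simps)
    qed simp
    finally show "Psi T z \<epsilon> u t0 \<le> C * (Psi T z \<epsilon> u 0 + \<epsilon>\<^sup>2)"
      using c by (simp add: C_def field_simps)
  qed
qed

end

theorem theorem5p4p1:
  fixes F G :: "real ^ 'n \<Rightarrow> real ^ 'n"
    and \<eta> q :: "real ^ 'n \<Rightarrow> real"
    and A :: "real ^ 'n ^ 'n"
    and ubar :: "real \<Rightarrow> real \<Rightarrow> real ^ 'n"
    and T \<alpha> \<beta> \<nu> M :: real
  assumes "0 < T"
    and "smooth_on UNIV F" and "smooth_on UNIV \<eta>" and "smooth_on UNIV q"
    and "continuous_on UNIV G" and "G 0 = 0"
    and "sym_pos_def A"
    and "balance_law_solution F G T ubar" and "decays_fast T ubar"
    and "0 < \<alpha>" and "0 < \<beta>"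
    and "strictly_convex \<eta>"
    and "\<forall>u. Du \<eta> u v* jacobian F (at u) = Du q u"
    and "\<forall>u. quad_le (mat \<beta>) (Du (Du \<eta>) u) \<and> quad_le (Du (Du \<eta>) u) (mat (\<alpha> / 2))"
    and "\<forall>u. \<eta> 0 \<le> \<eta> u" and "\<eta> 0 = 0" and "Du \<eta> 0 = 0"
    and "0 < \<nu>"
    and "\<forall>u. quad_le (mat \<nu>)
           ((1 / 2) *\<^sub>R (A ** Du (Du \<eta>) u + Du (Du \<eta>) u ** A)
            - \<alpha> *\<^sub>R (transpose (jacobian F (at u)) ** jacobian F (at u)))"
    and "0 < M"
    and "\<forall>u. norm (Du (Du F) u) \<le> M" and "\<forall>u. norm (Du (Du (Du \<eta>)) u) \<le> M"
    and "\<forall>K. compact K \<longrightarrow> (\<exists>L>0. \<forall>u. \<forall>w\<in>K. norm (G u - G w) \<le> L * norm (u - w))"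
  shows "\<exists>C>0. \<forall>u v :: real \<Rightarrow> real \<Rightarrow> real \<Rightarrow> real ^ 'n.
           (\<forall>\<epsilon>>0. relaxation_solution F G A \<epsilon> T (u \<epsilon>) (v \<epsilon>) \<and> decays_fast T (u \<epsilon>)) \<longrightarrow>
           (\<forall>\<epsilon>>0. \<forall>t\<in>{0..T}. Psi T ubar \<epsilon> (u \<epsilon>) t \<le> C * (Psi T ubar \<epsilon> (u \<epsilon>) 0 + \<epsilon>\<^sup>2))"
proof -
  interpret entropy_system F \<eta> q A \<alpha> \<beta> \<nu> M
    using assms by unfold_locales auto
  obtain C where "0 < C" "\<And>\<epsilon> u v t. 0 < \<epsilon> \<Longrightarrow> relaxation_solution F G A \<epsilon> T u v \<Longrightarrow>
      decays_fast T u \<Longrightarrow> t \<in> {0..T} \<Longrightarrow> Psi T ubar \<epsilon> u t \<le> C * (Psi T ubar \<epsilon> u 0 + \<epsilon>\<^sup>2)"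
    using stability_estimate[of T G ubar] assms by metis
  then show ?thesis
    by blast
qed

end
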